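(* Let $\eta,\zeta,k$ be positive constants and let $\sigma$ be a real parameter with $\sigma<0$ or $\sigma\in(0,1)$. Let $K$, $G$, $C$, $Q$ be the finite element matrices defined in the context, and set $$\mathcal{R} = -\frac{1}{\sigma\eta}GK^{-1}G^T + \frac{1}{\sigma\eta^2}GK^{-1}G^T\left(\frac{1}{\eta}GK^{-1}G^T+\frac{1}{\zeta}Q\right)^{-1}GK^{-1}G^T - \frac{k}{\sigma}C,$$ $$\mathcal{S} = -\left(\frac{1}{\eta}GK^{-1}G^T+\zeta^{-1}Q\right),\qquad \mathcal{T} = -\frac{1}{\eta}GK^{-1}G^T .$$ Then $\mathcal{R}$ is invertible, and the generalised eigenvalue problem $$\begin{bmatrix} \eta K & G^T & G^T \\ G & -kC & 0 \\ G & 0 & -\zeta^{-1}Q\end{bmatrix}\begin{bmatrix}u \\ p \\ p_c\end{bmatrix} = \Phi\begin{bmatrix}\eta K & 0 & 0\\ G & \mathcal{R} & 0\\ G & \mathcal{T} & \mathcal{S}\end{bmatrix}\begin{bmatrix}u \\ p \\ p_c\end{bmatrix}$$ has only two distinct eigenvalues, $\Phi_1=1$ and $\Phi_2=\sigma$. Furthermore, the eigenvectors corresponding to the eigenvalue $\Phi_1=1$ have the form $[u^T\ 0\ 0]^T$.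
   Context: Let $\Omega\subset\mathbb{R}^d$, $1\le d\le 3$, be a domain, let ${\bf D}{\bf u}=(\nabla{\bf u}+(\nabla{\bf u})^T)/2$, and let $L^2_0(\Omega)=\{q\in L^2(\Omega):\int_\Omega q\,dx=0\}$. Let ${\bf X}_h\subset {\bf H}^1_0(\Omega)=H_0^1(\Omega)^d$ and $M_h\subset H^1(\Omega)\cap L^2_0(\Omega)$ be finite-dimensional (nonzero) spaces with bases, $n_u=\dim {\bf X}_h$, $n_p=\dim M_h$; velocity vectors $u\in\mathbb{R}^{n_u}$ and pressure vectors $p,p_c\in\mathbb{R}^{n_p}$ are coefficient vectors with respect to these bases. The matrices $K\in\mathbb{R}^{n_u\times n_u}$, $G\in\mathbb{R}^{n_p\times n_u}$, $C,Q\in\mathbb{R}^{n_p\times n_p}$ are the matrices, with respect to these bases, of the bilinear forms $$({\bf u},{\bf v})\mapsto\int_\Omega {\bf D}{\bf u}:{\bf D}{\bf v}\,dx-\int_\Omega\tfrac13(\nabla\cdot{\bf u})(\nabla\cdot{\bf v})\,dx,\qquad (q,{\bf v})\mapsto-\int_\Omega q\,\nabla\cdot{\bf v}\,dx,$$ $$(p,q)\mapsto\int_\Omega\nabla p\cdot\nabla q\,dx,\qquad (p,q)\mapsto\int_\Omega pq\,dx,$$ respectively. Thus $K$ and $Q$ are symmetric positive definite and $C$ is symmetric positive semi-definite. Standing assumption: the only pressures annihilated by the discrete gradient $G^T$ are constants; since constants are excluded from the pressure space, $G^T$ is injective on $\mathbb{R}^{n_p}$ and $GK^{-1}G^T$ is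 symmetric positive definite. *)

theory Defs
  imports "HOL-Analysis.Analysis"
begin

section \<open>Sobolev spaces\<close>

text \<open>
  Functions on a domain \<open>\<Omega>\<close> are represented by total functions on the whole space, of which only
  the restriction to \<open>\<Omega>\<close>, up to null sets, is relevant. The sets of functions below therefore
  contain all representatives of each equivalence class.
\<close>

definition is_domain :: "(real^'d) set \<Rightarrow> bool" where
  "is_domain \<Omega> \<longleftrightarrow> open \<Omega> \<and> connected \<Omega> \<and> \<Omega> \<noteq> {}"

definition partial :: "'d::finite \<Rightarrow> (real^'d \<Rightarrow> real) \<Rightarrow> real^'d \<Rightarrow> real" where
  "partial i f x = frechet_derivative f (at x) (axis i 1)"

primrec C_k :: "nat \<Rightarrow> (real^'d::finite \<Rightarrow> real) \<Rightarrow> bool" where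
  "C_k 0 f \<longleftrightarrow> continuous_on UNIV f"
| "C_k (Suc n) f \<longleftrightarrow> f differentiable_on UNIV \<and> (\<forall>i. C_k n (partial i f))"

definition test_function :: "(real^'d::finite) set \<Rightarrow> (real^'d \<Rightarrow> real) \<Rightarrow> bool" where
  "test_function \<Omega> \<phi> \<longleftrightarrow>
     (\<forall>n. C_k n \<phi>) \<and> compact (closure {x. \<phi> x \<noteq> 0}) \<and> closure {x. \<phi> x \<noteq> 0} \<subseteq> \<Omega>"

definition L2 :: "(real^'d::finite) set \<Rightarrow> (real^'d \<Rightarrow> real) set" where
  "L2 \<Omega> = {f. f \<in> borel_measurable (lebesgue_on \<Omega>) \<and>
               integrable (lebesgue_on \<Omega>) (\<lambda>x. (f x)\<^sup>2)}"

text \<open>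
  Integrability is automatic if \<open>\<Omega>\<close> has finite measure. It is required explicitly because
  the Bochner integral of a non-integrable function is 0 by convention.
\<close>

definition L2_0 :: "(real^'d::finite) set \<Rightarrow> (real^'d \<Rightarrow> real) set" where
  "L2_0 \<Omega> = {f \<in> L2 \<Omega>. integrable (lebesgue_on \<Omega>) f \<and> (LINT x|lebesgue_on \<Omega>. f x) = 0}"

definition has_weak_partial ::
  "(real^'d::finite) set \<Rightarrow> 'd \<Rightarrow> (real^'d \<Rightarrow> real) \<Rightarrow> (real^'d \<Rightarrow> real) \<Rightarrow> bool" where
  "has_weak_partial \<Omega> i f g \<longleftrightarrow> g \<in> L2 \<Omega> \<and>
     (\<forall>\<phi>. test_function \<Omega> \<phi> \<longrightarrow>
        (LINT x|lebesgue_on \<Omega>. f x * partial i \<phi> x) = - (LINT x|lebesgue_on \<Omega>. g x * \<phi> x))"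

text \<open>Determined up to a null set for functions in \<open>H1\<close>; arbitrary otherwise.\<close>

definition weak_partial ::
  "(real^'d::finite) set \<Rightarrow> 'd \<Rightarrow> (real^'d \<Rightarrow> real) \<Rightarrow> real^'d \<Rightarrow> real" where
  "weak_partial \<Omega> i f = (SOME g. has_weak_partial \<Omega> i f g)"

definition H1 :: "(real^'d::finite) set \<Rightarrow> (real^'d \<Rightarrow> real) set" where
  "H1 \<Omega> = {f \<in> L2 \<Omega>. \<forall>i. \<exists>g. has_weak_partial \<Omega> i f g}"

text \<open>
  Closure of the test functions in the \<open>H1\<close> norm; for a test function the weak partial
  derivatives are the classical ones.
\<close>

definition H1_0 :: "(real^'d::finite) set \<Rightarrow> (real^'d \<Rightarrow> real) set" where
  "H1_0 \<Omega> = {f \<in> H1 \<Omega>. \<exists>\<phi> :: nat \<Rightarrow> real^'d \<Rightarrow> real.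
     (\<forall>n. test_function \<Omega> (\<phi> n)) \<and>
     (\<lambda>n. (LINT x|lebesgue_on \<Omega>. (\<phi> n x - f x)\<^sup>2) +
           (\<Sum>i\<in>UNIV. LINT x|lebesgue_on \<Omega>. (partial i (\<phi> n) x - weak_partial \<Omega> i f x)\<^sup>2))
       \<longlonglongrightarrow> 0}"

definition H1_0_vec :: "(real^'d::finite) set \<Rightarrow> (real^'d \<Rightarrow> real^'d) set" where
  "H1_0_vec \<Omega> = {v. \<forall>i. (\<lambda>x. v x $ i) \<in> H1_0 \<Omega>}"

definition grad :: "(real^'d::finite) set \<Rightarrow> (real^'d \<Rightarrow> real) \<Rightarrow> real^'d \<Rightarrow> real^'d" where
  "grad \<Omega> q x = (\<chi> i. weak_partial \<Omega> i q x)"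

definition grad_vec :: "(real^'d::finite) set \<Rightarrow> (real^'d \<Rightarrow> real^'d) \<Rightarrow> real^'d \<Rightarrow> real^'d^'d" where
  "grad_vec \<Omega> v x = (\<chi> i j. weak_partial \<Omega> j (\<lambda>y. v y $ i) x)"

definition sym_grad :: "(real^'d::finite) set \<Rightarrow> (real^'d \<Rightarrow> real^'d) \<Rightarrow> real^'d \<Rightarrow> real^'d^'d" where
  "sym_grad \<Omega> v x = (1/2) *\<^sub>R (grad_vec \<Omega> v x + transpose (grad_vec \<Omega> v x))"

definition divergence :: "(real^'d::finite) set \<Rightarrow> (real^'d \<Rightarrow> real^'d) \<Rightarrow> real^'d \<Rightarrow> real" where
  "divergence \<Omega> v x = trace (grad_vec \<Omega> v x)"


section \<open>Finite element matrices\<close>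

definition combination ::
  "('n::finite \<Rightarrow> 'a \<Rightarrow> 'b::real_vector) \<Rightarrow> real^'n \<Rightarrow> 'a \<Rightarrow> 'b" where
  "combination b c x = (\<Sum>i\<in>UNIV. (c $ i) *\<^sub>R b i x)"

text \<open>
  The family \<open>b\<close> is a basis of the space \<open>V\<close> of functions modulo equality almost everywhere
  on \<open>\<Omega>\<close>. In particular, \<open>V\<close> has dimension \<open>CARD('n)\<close>, which is nonzero.
\<close>

definition basis_on ::
  "(real^'d::finite) set \<Rightarrow> ('n::finite \<Rightarrow> real^'d \<Rightarrow> 'b::real_vector) \<Rightarrow> (real^'d \<Rightarrow> 'b) set \<Rightarrow> bool"
  where
  "basis_on \<Omega> b V \<longleftrightarrow>
     V = {v. \<exists>c. AE x in lebesgue_on \<Omega>. v x = combination b c x} \<and>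
     (\<forall>c. (AE x in lebesgue_on \<Omega>. combination b c x = 0) \<longrightarrow> c = 0)"

text \<open>The inner product on matrices is the Frobenius product \<open>A : B\<close>.\<close>

definition K_form ::
  "(real^'d::finite) set \<Rightarrow> (real^'d \<Rightarrow> real^'d) \<Rightarrow> (real^'d \<Rightarrow> real^'d) \<Rightarrow> real" where
  "K_form \<Omega> u v =
     (LINT x|lebesgue_on \<Omega>. sym_grad \<Omega> u x \<bullet> sym_grad \<Omega> v x) -
     (LINT x|lebesgue_on \<Omega>. 1/3 * (divergence \<Omega> u x * divergence \<Omega> v x))"

definition G_form ::
  "(real^'d::finite) set \<Rightarrow> (real^'d \<Rightarrow> real) \<Rightarrow> (real^'d \<Rightarrow> real^'d) \<Rightarrow> real" where
  "G_form \<Omega> q v = - (LINT x|lebesgue_on \<Omega>. q x * divergence \<Omega> v x)"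

definition C_form ::
  "(real^'d::finite) set \<Rightarrow> (real^'d \<Rightarrow> real) \<Rightarrow> (real^'d \<Rightarrow> real) \<Rightarrow> real" where
  "C_form \<Omega> p q = (LINT x|lebesgue_on \<Omega>. grad \<Omega> p x \<bullet> grad \<Omega> q x)"

definition Q_form ::
  "(real^'d::finite) set \<Rightarrow> (real^'d \<Rightarrow> real) \<Rightarrow> (real^'d \<Rightarrow> real) \<Rightarrow> real" where
  "Q_form \<Omega> p q = (LINT x|lebesgue_on \<Omega>. p x * q x)"

definition form_matrix ::
  "('f \<Rightarrow> 'g \<Rightarrow> real) \<Rightarrow> ('m::finite \<Rightarrow> 'f) \<Rightarrow> ('n::finite \<Rightarrow> 'g) \<Rightarrow> real^'n^'m" where
  "form_matrix a b c = (\<chi> i j. a (b i) (c j))"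


section \<open>Block matrices and generalised eigenvalue problems\<close>

definition block_vec ::
  "'a^'l::finite \<Rightarrow> 'a^'m::finite \<Rightarrow> 'a^'n::finite \<Rightarrow> 'a^('l + 'm + 'n)" where
  "block_vec u v w =
     (\<chi> r. case r of Inl i \<Rightarrow> u $ i | Inr (Inl i) \<Rightarrow> v $ i | Inr (Inr i) \<Rightarrow> w $ i)"

definition block_mat ::
  "'a^'l^'l \<Rightarrow> 'a^'m^'l \<Rightarrow> 'a^'n^'l \<Rightarrow>
   'a^'l^'m \<Rightarrow> 'a^'m^'m \<Rightarrow> 'a^'n^'m \<Rightarrow>
   'a^'l^'n \<Rightarrow> 'a^'m^'n \<Rightarrow> 'a^'n^'n \<Rightarrow>
   'a^('l::finite + 'm::finite + 'n::finite)^('l + 'm + 'n)" where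
  "block_mat A11 A12 A13 A21 A22 A23 A31 A32 A33 =
     (\<chi> r. case r of
         Inl i \<Rightarrow> block_vec (A11 $ i) (A12 $ i) (A13 $ i)
       | Inr (Inl i) \<Rightarrow> block_vec (A21 $ i) (A22 $ i) (A23 $ i)
       | Inr (Inr i) \<Rightarrow> block_vec (A31 $ i) (A32 $ i) (A33 $ i))"

definition gen_eigenvector :: "'a::field^'n^'n \<Rightarrow> 'a^'n^'n \<Rightarrow> 'a \<Rightarrow> 'a^'n::finite \<Rightarrow> bool" where
  "gen_eigenvector A B \<Phi> x \<longleftrightarrow> x \<noteq> 0 \<and> A *v x = \<Phi> *s (B *v x)"

definition gen_eigenvalues :: "'a::field^'n^'n \<Rightarrow> 'a^'n::finite^'n \<Rightarrow> 'a set" where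
  "gen_eigenvalues A B = {\<Phi>. \<exists>x. gen_eigenvector A B \<Phi> x}"

abbreviation complex_mat :: "real^'n^'m \<Rightarrow> complex^'n^'m" where
  "complex_mat \<equiv> map_matrix complex_of_real"

end

theory Submission
  imports Defs
begin

text \<open>
  For \<open>u, v \<in> H\<^sub>0\<^sup>1\<close> the integral of \<open>\<nabla>u : (\<nabla>v)\<^sup>T\<close> equals that of \<open>div u div v\<close>, so the form defining \<open>K\<close>
  is \<open>1/2 \<integral> \<nabla>u : \<nabla>v + 1/6 \<integral> div u div v\<close>, which is positive definite in every dimension.
  Hence \<open>B = \<eta>\<^sup>-\<^sup>1 G K\<^sup>-\<^sup>1 G\<^sup>T\<close> is positive definite, and so is \<open>D = B - B (B + \<zeta>\<^sup>-\<^sup>1 Q)\<^sup>-\<^sup>1 B\<close>, the parallel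
  sum of \<open>B\<close> and \<open>\<zeta>\<^sup>-\<^sup>1 Q\<close>. With \<open>E = D + k C\<close> one has \<open>\<R> = - \<sigma>\<^sup>-\<^sup>1 E\<close>. Eliminating \<open>u\<close> and \<open>p\<^sub>c\<close> for
  \<open>\<Phi> \<noteq> 1\<close> leaves \<open>E p = (\<Phi> / \<sigma>) E p\<close>, which forces \<open>\<Phi> = \<sigma>\<close>; for \<open>\<Phi> = 1\<close> it leaves
  \<open>(D + (1 - \<sigma>) k C) p = 0\<close>, which forces \<open>p = p\<^sub>c = 0\<close>.
\<close>

section \<open>Block matrices and saddle point problems\<close>

text \<open>The domain may be unbounded, so that a function in \<open>H1_0\<close> with vanishing
  gradient has to be shown zero without a Poincare inequality. Integrating the j-th derivative of
  arctan(x_j) u^2 does this: it leaves the integral of u^2 against the positive weight 1 / (1 +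
  x_j^2). \<open>weak_partial\<close> chooses a representative for each function separately and is
  thus linear only up to null sets. Quadratic forms are therefore expressed through combinations of
  the weak derivatives of the basis functions, never through the weak derivative of a combination.
  The preconditioner is not symmetric, so real eigenvalues alone would not exclude non-real ones.
  The elimination is carried out over an arbitrary field and uses definiteness only in the form of
  injectivity, a property that passes from a real matrix to its complexification.\<close>

lemma sum_UNIV_Plus:
  fixes f :: "'a::finite + 'b::finite \<Rightarrow> 'c::comm_monoid_add"
  shows "(\<Sum>r\<in>UNIV. f r) = (\<Sum>i\<in>UNIV. f (Inl i)) + (\<Sum>i\<in>UNIV. f (Inr i))"
proof -
  have "sum f (UNIV <+> UNIV) = (\<Sum>i\<in>UNIV. f (Inl i)) + (\<Sum>i\<in>UNIV. f (Inr i))"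
    by (subst sum.Plus) (simp_all add: comp_def)
  then show ?thesis by simp
qed

lemma block_mat_mult_block_vec:
  "block_mat A11 A12 A13 A21 A22 A23 A31 A32 A33 *v block_vec u v w =
   block_vec (A11 *v u + A12 *v v + A13 *v w) (A21 *v u + A22 *v v + A23 *v w)
     (A31 *v u + A32 *v v + A33 *v w)"
  by (simp add: block_mat_def block_vec_def matrix_vector_mult_def vec_eq_iff sum_UNIV_Plus
      add.assoc split: sum.split)

lemma block_vec_eq_iff:
  "block_vec u v w = block_vec u' v' w' \<longleftrightarrow> u = u' \<and> v = v' \<and> w = w'"
proof
  assume eq: "block_vec u v w = block_vec u' v' w'"
  have "block_vec u v w $ Inl i = block_vec u' v' w' $ Inl i"
    "block_vec u v w $ Inr (Inl j) = block_vec u' v' w' $ Inr (Inl j)"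
    "block_vec u v w $ Inr (Inr l) = block_vec u' v' w' $ Inr (Inr l)" for i j l
    by (simp_all add: eq)
  then show "u = u' \<and> v = v' \<and> w = w'"
    by (simp add: block_vec_def vec_eq_iff)
qed simp

lemma block_vec_cases:
  fixes x :: "'a^('l::finite + 'm::finite + 'n::finite)"
  obtains u v w where "x = block_vec u v w"
proof
  show "x = block_vec (\<chi> i. x $ Inl i) (\<chi> i. x $ Inr (Inl i)) (\<chi> i. x $ Inr (Inr i))"
    by (simp add: block_vec_def vec_eq_iff split: sum.split)
qed

lemma scale_block_vec: "c *s block_vec u v w = block_vec (c *s u) (c *s v) (c *s w)"
  by (simp add: block_vec_def vec_eq_iff split: sum.split)

lemma block_vec_0: "block_vec 0 0 0 = 0"
  by (simp add: block_vec_def vec_eq_iff split: sum.split)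

lemma block_vec_eq_0_iff: "block_vec u v w = 0 \<longleftrightarrow> u = 0 \<and> v = 0 \<and> w = 0"
  unfolding block_vec_0 [symmetric] block_vec_eq_iff ..

lemma matrix_vector_mult_uminus_left: "(- A) *v x = - (A *v x)"
  for A :: "'a::ring_1^'n^'m"
  by (simp add: matrix_vector_mult_def vec_eq_iff sum_negf)

text \<open>Eliminating \<open>u\<close> and then \<open>q\<close> from \<open>A\<close> leaves
  \<open>- (D + C)\<close> acting on \<open>p\<close>. Hypothesis \<open>R\<close> says that
  \<open>R\<close> is this Schur complement divided by \<open>s\<close>, and this scaling is what
  reappears as the second eigenvalue. \<open>N\<close> and \<open>W\<close> are the inverses of
  \<open>K\<close> and \<open>B + Q\<close>. The injectivity hypotheses \<open>Gt\<close>,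
  \<open>E\<close> and \<open>F\<close> are all that remains of positive definiteness, so that the
  lemma applies to real and to complex matrices.\<close>

lemma saddle_point_eigenpairs:
  fixes K N :: "'a::field^'nu::finite^'nu" and G :: "'a^'nu^'np::finite" and Gt :: "'a^'np^'nu"
    and B C D Q R W :: "'a^'np^'np" and s :: 'a
  assumes KN: "K ** N = mat 1" and NK: "N ** K = mat 1"
    and B: "B = G ** N ** Gt" and W: "W ** (B + Q) = mat 1" "(B + Q) ** W = mat 1"
    and D: "D = B - B ** W ** B"
    and Gt: "\<And>p. Gt *v p = 0 \<Longrightarrow> p = 0"
    and E: "\<And>p. D *v p + C *v p = 0 \<Longrightarrow> p = 0"
    and F: "\<And>p. D *v p + (1 - s) *s (C *v p) = 0 \<Longrightarrow> p = 0"
    and R: "\<And>p. s *s (R *v p) = - (D *v p + C *v p)"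
    and s: "s \<noteq> 0" "s \<noteq> 1"
  defines "A \<equiv> block_mat K Gt Gt G (- C) 0 G 0 (- Q)"
    and "P \<equiv> block_mat K 0 0 G R 0 G (- B) (- (B + Q))"
  shows "gen_eigenvalues A P = {1, s}"
    and "gen_eigenvector A P 1 x \<Longrightarrow> \<exists>u. x = block_vec u 0 0"
proof -
  have eig: "gen_eigenvector A P \<Phi> (block_vec u p q) \<longleftrightarrow>
      (u \<noteq> 0 \<or> p \<noteq> 0 \<or> q \<noteq> 0) \<and>
      K *v u + Gt *v (p + q) = \<Phi> *s (K *v u) \<and>
      G *v u - C *v p = \<Phi> *s (G *v u + R *v p) \<and>
      G *v u - Q *v q = \<Phi> *s (G *v u - B *v p - (B *v q + Q *v q))" for \<Phi> u p q
    unfolding gen_eigenvector_def A_def P_def block_mat_mult_block_vec scale_block_vec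
      block_vec_eq_iff block_vec_eq_0_iff
    by (simp add: matrix_vector_mult_uminus_left matrix_vector_mult_add_rdistrib
        matrix_vector_mult_diff_rdistrib matrix_vector_right_distrib add.assoc diff_diff_eq
        del: minus_add_distrib add_uminus_conv_diff)
      (simp only: diff_conv_add_uminus minus_add_distrib minus_minus add_ac)
  have NKv: "N *v (K *v u) = u" for u
    by (simp add: matrix_vector_mul_assoc NK)
  have KNv: "K *v (N *v u) = u" for u
    by (simp add: matrix_vector_mul_assoc KN)
  have Wv: "W *v (B *v p + Q *v p) = p" for p
    using W(1) by (metis matrix_vector_mul_assoc matrix_vector_mult_add_rdistrib matrix_vector_mul_lid)
  have Wv': "B *v (W *v p) + Q *v (W *v p) = p" for p
    using W(2) by (metis matrix_vector_mul_assoc matrix_vector_mult_add_rdistrib matrix_vector_mul_lid)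
  have Bv: "B *v p = G *v (N *v (Gt *v p))" for p
    by (simp add: B matrix_vector_mul_assoc matrix_mul_assoc)
  have Dv: "D *v p = B *v p - B *v (W *v (B *v p))" for p
    by (simp add: D matrix_vector_mult_diff_rdistrib matrix_vector_mul_assoc matrix_mul_assoc)
  have one: "p = 0 \<and> q = 0" if "gen_eigenvector A P 1 (block_vec u p q)" for u p q
  proof -
    have 1: "Gt *v (p + q) = 0" and "G *v u - C *v p = G *v u + R *v p"
      using that unfolding eig vector_smult_lid by simp_all
    then have 2: "- (C *v p) = R *v p"
      by (metis add_left_cancel diff_conv_add_uminus)
    \<comment> \<open>Multiplication by \<open>s\<close> replaces \<open>R\<close> by
      \<open>- (D + C)\<close>; collecting the two multiples of \<open>C\<close> produces the
      operator of \<open>F\<close>.\<close>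
    have "s *s (- (C *v p)) = - (D *v p + C *v p)"
      using R 2 by metis
    then have "D *v p + (1 - s) *s (C *v p) = 0"
      by (simp add: vec_eq_iff algebra_simps)
    then have "p = 0" by (rule F)
    then show ?thesis using Gt [OF 1] by simp
  qed
  show "\<exists>u. x = block_vec u 0 0" if "gen_eigenvector A P 1 x"
    using one that by (metis block_vec_cases)
  have other: "\<Phi> = s" if "\<Phi> \<noteq> 1" and ev: "gen_eigenvector A P \<Phi> (block_vec u p q)" for \<Phi> u p q
  proof -
    have nz: "u \<noteq> 0 \<or> p \<noteq> 0 \<or> q \<noteq> 0"
      and 1: "K *v u + Gt *v (p + q) = \<Phi> *s (K *v u)"
      and 2: "G *v u - C *v p = \<Phi> *s (G *v u + R *v p)"
      and 3: "G *v u - Q *v q = \<Phi> *s (G *v u - B *v p - (B *v q + Q *v q))"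
      using ev unfolding eig by auto
    have "Gt *v (p + q) = (\<Phi> - 1) *s (K *v u)"
      using 1 by (simp add: vec_eq_iff algebra_simps)
    then have u: "N *v (Gt *v (p + q)) = (\<Phi> - 1) *s u"
      by (simp only: vec.scale NKv)
    then have Gu: "B *v (p + q) = (\<Phi> - 1) *s (G *v u)"
      by (simp only: Bv vec.scale)
    \<comment> \<open>Substituting \<open>B (p + q)\<close> for \<open>(\<Phi> - 1) G u\<close>
      turns the third row into a multiple of \<open>1 - \<Phi>\<close>. The relation between
      \<open>p\<close> and \<open>q\<close> that results is the same for every \<Phi> other than
      1.\<close>
    have "(1 - \<Phi>) * ((B *v p) $ i + ((B *v q) $ i + (Q *v q) $ i)) = 0" for i
      using arg_cong [OF 3, of "\<lambda>x. x $ i"] arg_cong [OF Gu, of "\<lambda>x. x $ i"]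
      by (simp add: matrix_vector_right_distrib) algebra
    then have "(B *v p) $ i + ((B *v q) $ i + (Q *v q) $ i) = 0" for i
      using \<open>\<Phi> \<noteq> 1\<close> by (metis eq_iff_diff_eq_0 mult_eq_0_iff)
    then have "B *v q + Q *v q = - (B *v p)"
      by (simp add: vec_eq_iff) (metis add_eq_0_iff)
    then have q: "q = - (W *v (B *v p))"
      by (metis Wv vec.neg)
    have "(B *v (p + q) + C *v p) $ i = (- \<Phi> *s (R *v p)) $ i" for i
      using arg_cong [OF 2, of "\<lambda>x. x $ i"] arg_cong [OF Gu, of "\<lambda>x. x $ i"]
      by simp algebra
    then have "B *v (p + q) + C *v p = - \<Phi> *s (R *v p)"
      by (simp add: vec_eq_iff)
    then have "D *v p + C *v p = - \<Phi> *s (R *v p)"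
      by (simp add: q Dv matrix_vector_right_distrib vec.neg matrix_vector_mult_diff_distrib)
    then have "s *s (D *v p + C *v p) = - \<Phi> *s (s *s (R *v p))"
      by (simp add: vector_smult_assoc mult.commute)
    also have "\<dots> = \<Phi> *s (D *v p + C *v p)"
      by (simp add: R vec_eq_iff)
    finally have *: "s *s (D *v p + C *v p) = \<Phi> *s (D *v p + C *v p)" .
    \<comment> \<open>The other two components are determined by \<open>p\<close>, so
      \<open>p = 0\<close> would make the whole eigenvector zero.\<close>
    have "p \<noteq> 0"
    proof
      assume "p = 0"
      with q have "q = 0" by simp
      with u \<open>p = 0\<close> have "(\<Phi> - 1) *s u = 0" by simp
      with \<open>\<Phi> \<noteq> 1\<close> have "u = 0" by (metis vector_mul_eq_0 eq_iff_diff_eq_0)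
      with nz \<open>p = 0\<close> \<open>q = 0\<close> show False by simp
    qed
    then have "D *v p + C *v p \<noteq> 0" using E by blast
    with * show "\<Phi> = s" by (metis vector_mul_rcancel)
  qed
  have "\<Phi> \<in> {1, s}" if "gen_eigenvector A P \<Phi> x" for \<Phi> x
    using other that by (metis block_vec_cases insert_iff)
  \<comment> \<open>The first block columns of \<open>A\<close> and \<open>P\<close> coincide, hence
    any nonzero velocity works; \<open>1\<close> is the vector of ones.\<close>
  moreover have "gen_eigenvector A P 1 (block_vec 1 0 0)"
    unfolding eig by (simp add: vec_eq_iff)
  moreover have "\<exists>x. gen_eigenvector A P s x"
  proof -
    \<comment> \<open>Any nonzero pressure extends to an eigenvector for \<open>s\<close>:
      \<open>q\<close> is forced by the relation found in the elimination, and \<open>u\<close>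
      solves the first row, where \<open>s \<noteq> 1\<close> permits the division.\<close>
    define p where "p = (1 :: 'a^'np)"
    define q where "q = - (W *v (B *v p))"
    define u where "u = inverse (s - 1) *s (N *v (Gt *v (p + q)))"
    have "(s - 1) *s (G *v u) = B *v (p + q)"
      using s by (simp add: u_def vec.scale vector_smult_assoc Bv del: vector_sub_rdistrib)
    also have "\<dots> = D *v p"
      by (simp add: q_def Dv matrix_vector_mult_diff_distrib)
    finally have Gu: "(s - 1) *s (G *v u) = D *v p" .
    have Bq: "B *v q + Q *v q = - (B *v p)"
      unfolding q_def by (simp only: vec.neg Wv' flip: minus_add_distrib)
    have "B *v q = - (B *v (W *v (B *v p)))"
      by (simp only: q_def vec.neg)
    moreover have "Q *v q = - (B *v p) - B *v q"
      using Bq by (metis add_diff_cancel_left')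
    ultimately have Qq: "Q *v q = - (D *v p)"
      unfolding Dv by simp
    have Ku: "(s - 1) *s (K *v u) = Gt *v (p + q)"
      using s by (simp add: u_def vec.scale vector_smult_assoc KNv del: vector_sub_rdistrib)
    have 1: "K *v u + Gt *v (p + q) = s *s (K *v u)"
      unfolding Ku [symmetric] by (simp add: vec_eq_iff left_diff_distrib)
    have "(G *v u - C *v p) $ i = (s *s (G *v u + R *v p)) $ i" for i
      using arg_cong [OF Gu, of "\<lambda>x. x $ i"] arg_cong [OF R [of p], of "\<lambda>x. x $ i"]
      by (simp add: eq_diff_eq diff_eq_eq add_ac distrib_left right_diff_distrib left_diff_distrib)
    then have 2: "G *v u - C *v p = s *s (G *v u + R *v p)"
      unfolding vec_eq_iff by blast
    have "(G *v u - Q *v q) $ i = (s *s (G *v u - B *v p - (B *v q + Q *v q))) $ i" for i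
      using arg_cong [OF Gu, of "\<lambda>x. x $ i"] unfolding Bq unfolding Qq
      by (simp add: eq_diff_eq diff_eq_eq add_ac distrib_left right_diff_distrib left_diff_distrib)
    then have 3: "G *v u - Q *v q = s *s (G *v u - B *v p - (B *v q + Q *v q))"
      unfolding vec_eq_iff by blast
    have "p \<noteq> 0" by (simp add: p_def vec_eq_iff)
    with 1 2 3 have "gen_eigenvector A P s (block_vec u p q)" unfolding eig by blast
    then show ?thesis by blast
  qed
  ultimately show "gen_eigenvalues A P = {1, s}"
    unfolding gen_eigenvalues_def by blast
qed

section \<open>Complexified matrices\<close>

lemma complex_mat_mult: "complex_mat (A ** B) = complex_mat A ** complex_mat B"
  by (simp add: vec_eq_iff matrix_matrix_mult_def)

lemma complex_mat_add: "complex_mat (A + B) = complex_mat A + complex_mat B"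
  by (simp add: vec_eq_iff)

lemma complex_mat_diff: "complex_mat (A - B) = complex_mat A - complex_mat B"
  by (simp add: vec_eq_iff)

lemma complex_mat_uminus: "complex_mat (- A) = - complex_mat A"
  by (simp add: vec_eq_iff)

lemma complex_mat_0: "complex_mat 0 = 0"
  by (simp add: vec_eq_iff)

lemma complex_mat_mat: "complex_mat (mat c) = mat (complex_of_real c)"
  by (simp add: vec_eq_iff mat_def)

lemma complex_mat_scaleR_mult: "complex_mat (c *\<^sub>R A) *v x = complex_of_real c *s (complex_mat A *v x)"
  by (simp add: vec_eq_iff matrix_vector_mult_def sum_distrib_left mult.assoc)

lemma complex_mat_block_mat:
  "complex_mat (block_mat A11 A12 A13 A21 A22 A23 A31 A32 A33) =
   block_mat (complex_mat A11) (complex_mat A12) (complex_mat A13)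
     (complex_mat A21) (complex_mat A22) (complex_mat A23)
     (complex_mat A31) (complex_mat A32) (complex_mat A33)"
  by (simp add: vec_eq_iff block_mat_def block_vec_def split: sum.split)

text \<open>A real matrix acts separately on the real and the imaginary parts of a vector.\<close>

lemma complex_mat_injective:
  fixes M :: "real^'n^'m"
  assumes inj: "\<And>x. M *v x = 0 \<Longrightarrow> x = 0" and z: "complex_mat M *v z = 0"
  shows "z = 0"
proof -
  have "(M *v (\<chi> j. Re (z $ j))) $ i = Re ((complex_mat M *v z) $ i)"
    "(M *v (\<chi> j. Im (z $ j))) $ i = Im ((complex_mat M *v z) $ i)" for i
    by (simp_all add: matrix_vector_mult_def)
  then have "M *v (\<chi> j. Re (z $ j)) = 0" "M *v (\<chi> j. Im (z $ j)) = 0"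
    by (simp_all add: vec_eq_iff z)
  then have "(\<chi> j. Re (z $ j)) = 0" "(\<chi> j. Im (z $ j)) = 0"
    by (blast intro: inj)+
  then show ?thesis by (simp add: vec_eq_iff complex_eq_iff)
qed

section \<open>Positive definite matrices\<close>

text \<open>Symmetry is not part of this notion.\<close>

definition pos_def :: "real^'n::finite^'n \<Rightarrow> bool" where
  "pos_def M \<longleftrightarrow> (\<forall>x. x \<noteq> 0 \<longrightarrow> x \<bullet> (M *v x) > 0)"

lemma pos_def_injective: "pos_def M \<Longrightarrow> M *v x = 0 \<Longrightarrow> x = 0"
  by (force simp: pos_def_def)

lemma pos_def_invertible: "pos_def M \<Longrightarrow> invertible M"
  unfolding invertible_left_inverse matrix_left_invertible_ker by (metis pos_def_injective)

lemma pos_def_scaleR: "pos_def M \<Longrightarrow> c > 0 \<Longrightarrow> pos_def (c *\<^sub>R M)"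
  by (simp add: pos_def_def scaleR_matrix_vector_assoc [symmetric])

lemma pos_def_add:
  assumes "pos_def M" and "\<And>x. x \<bullet> (N *v x) \<ge> 0"
  shows "pos_def (M + N)"
  using assms by (simp add: pos_def_def matrix_vector_mult_add_rdistrib inner_add_right add_pos_nonneg)

lemma pos_def_nonneg: "pos_def M \<Longrightarrow> x \<bullet> (M *v x) \<ge> 0"
  by (cases "x = 0") (auto simp: pos_def_def intro: less_imp_le)

lemma matrix_inv_both:
  assumes "invertible M"
  shows "M ** matrix_inv M = mat 1" "matrix_inv M ** M = mat 1"
  using someI_ex [OF assms [unfolded invertible_def]] by (simp_all add: matrix_inv_def)

text \<open>The quadratic form at \<open>p\<close> equals the energy
  \<open>y \<bullet> (K *v y)\<close> of \<open>y = K^-1 G^T p\<close>, and \<open>y\<close> is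
  nonzero because \<open>G^T\<close> is injective.\<close>

lemma pos_def_Schur:
  fixes K :: "real^'nu::finite^'nu" and G :: "real^'nu^'np::finite"
  assumes K: "pos_def K" and G: "\<And>p. transpose G *v p = 0 \<Longrightarrow> p = 0"
  shows "pos_def (G ** matrix_inv K ** transpose G)"
  unfolding pos_def_def
proof (intro allI impI)
  fix p :: "real^'np" assume "p \<noteq> 0"
  define y where "y = matrix_inv K *v (transpose G *v p)"
  have Ky: "K *v y = transpose G *v p"
    by (simp add: y_def matrix_vector_mul_assoc matrix_mul_assoc
        matrix_inv_both [OF pos_def_invertible [OF K]] del: transpose_matrix_vector)
  have "p \<bullet> ((G ** matrix_inv K ** transpose G) *v p) = p \<bullet> (G *v y)"
    by (simp add: y_def matrix_vector_mul_assoc matrix_mul_assoc del: transpose_matrix_vector)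
  also have "\<dots> = y \<bullet> (K *v y)"
    by (metis Ky dot_lmul_matrix inner_commute transpose_matrix_vector)
  also have "\<dots> > 0"
  proof -
    have "y \<noteq> 0" using Ky G \<open>p \<noteq> 0\<close> by fastforce
    then show ?thesis using K by (simp add: pos_def_def)
  qed
  finally show "p \<bullet> ((G ** matrix_inv K ** transpose G) *v p) > 0" .
qed

text \<open>As with two resistors in parallel, \<open>x\<close> is split into \<open>y\<close> and
  \<open>x - y\<close> so that \<open>Q y = B (x - y)\<close>. The form is then the
  \<open>B\<close>-energy of \<open>x - y\<close> plus the \<open>Q\<close>-energy of
  \<open>y\<close>, and these two vectors cannot both vanish.\<close>

lemma pos_def_parallel_sum:
  fixes B Q :: "real^'n::finite^'n"
  assumes B: "pos_def B" and Q: "pos_def Q"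
  shows "pos_def (B - B ** matrix_inv (B + Q) ** B)"
  unfolding pos_def_def
proof (intro allI impI)
  fix x :: "real^'n" assume "x \<noteq> 0"
  define y where "y = matrix_inv (B + Q) *v (B *v x)"
  have "(B + Q) *v y = B *v x"
    by (simp add: y_def matrix_vector_mul_assoc matrix_mul_assoc
        matrix_inv_both [OF pos_def_invertible [OF pos_def_add [OF B pos_def_nonneg [OF Q]]]])
  then have Qy: "Q *v y = B *v (x - y)"
    by (simp add: matrix_vector_mult_add_rdistrib matrix_vector_mult_diff_distrib eq_diff_eq add.commute)
  have "x \<bullet> ((B - B ** matrix_inv (B + Q) ** B) *v x) = x \<bullet> (B *v (x - y))"
    by (simp add: y_def matrix_vector_mult_diff_rdistrib matrix_vector_mult_diff_distrib
        matrix_vector_mul_assoc matrix_mul_assoc)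
  also have "\<dots> = (x - y) \<bullet> (B *v (x - y)) + y \<bullet> (Q *v y)"
    by (simp add: Qy inner_diff_left)
  also have "\<dots> > 0"
  proof (cases "y = 0")
    case True
    then show ?thesis using B \<open>x \<noteq> 0\<close> by (simp add: pos_def_def)
  next
    case False
    then have "y \<bullet> (Q *v y) > 0" using Q by (simp add: pos_def_def)
    then show ?thesis using pos_def_nonneg [OF B, of "x - y"] by linarith
  qed
  finally show "x \<bullet> ((B - B ** matrix_inv (B + Q) ** B) *v x) > 0" .
qed

section \<open>Difference quotients\<close>

lemma integral_lborel_translate:
  fixes f :: "'a::euclidean_space \<Rightarrow> real"
  assumes "continuous_on UNIV f"
  shows "(LINT x|lborel. f (x + c)) = (LINT x|lborel. f x)"
proof -
  have "(LINT x|distr lborel borel ((+) c). f x) = (LINT x|lborel. f (c + x))"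
    using assms by (intro integral_distr) (auto intro: borel_measurable_continuous_onI)
  then show ?thesis by (simp add: lborel_distr_plus add.commute)
qed

lemma integrable_continuous_compact_support:
  fixes f :: "'a::euclidean_space \<Rightarrow> real"
  assumes "continuous_on UNIV f" and "\<And>x. norm x > r \<Longrightarrow> f x = 0"
  shows "integrable lborel f"
proof -
  have "integrable lborel (\<lambda>x. indicator (cball 0 r) x *\<^sub>R f x)"
    using assms(1) by (intro borel_integrable_compact) (auto intro: continuous_on_subset)
  moreover have "(\<lambda>x. indicator (cball 0 r) x *\<^sub>R f x) = f"
    using assms(2) by (fastforce simp: indicator_def not_le)
  ultimately show ?thesis by simp
qed

text \<open>Continuity is required of the derivative in the one direction \<open>i\<close> only, so
  that it has to be verified just for the derivative being integrated.\<close>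

definition C1_compact :: "'d \<Rightarrow> (real^'d::finite \<Rightarrow> real) \<Rightarrow> bool" where
  "C1_compact i f \<longleftrightarrow> (\<forall>x. f differentiable at x) \<and> continuous_on UNIV (partial i f) \<and>
     (\<exists>r. \<forall>x. norm x > r \<longrightarrow> f x = 0)"

lemma C1_compact_continuous: "C1_compact i f \<Longrightarrow> continuous_on UNIV f"
  by (auto simp: C1_compact_def intro!: differentiable_imp_continuous_on simp: differentiable_on_def
      intro: differentiable_at_withinI)

lemma C1_compact_support:
  assumes "C1_compact i f" obtains r where "\<And>x. norm x > r \<Longrightarrow> f x = 0"
  using assms unfolding C1_compact_def by blast

lemma partialI:
  assumes "(f has_derivative f') (at x)"
  shows "partial i f x = f' (axis i 1)"
  using frechet_derivative_at [OF assms] by (simp add: partial_def)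

lemma partial_eq_0:
  assumes "open U" "x \<in> U" "\<And>y. y \<in> U \<Longrightarrow> f y = 0"
  shows "partial i f x = 0"
proof -
  have "((\<lambda>_. 0) has_derivative (\<lambda>_. 0)) (at x)" by simp
  then have "(f has_derivative (\<lambda>_. 0)) (at x)"
    by (rule has_derivative_transform_within_open) (use assms in auto)
  then show ?thesis by (rule partialI)
qed

lemma C1_compact_partial_line:
  assumes "C1_compact i f"
  shows "((\<lambda>t. f (x + t *\<^sub>R axis i 1)) has_real_derivative partial i f (x + t *\<^sub>R axis i 1)) (at t)"
proof -
  let ?y = "x + t *\<^sub>R axis i 1"
  have f': "(f has_derivative frechet_derivative f (at ?y)) (at ?y)"
    using assms by (simp add: C1_compact_def flip: frechet_derivative_works)
  have "((\<lambda>t. f (x + t *\<^sub>R axis i 1)) has_derivative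
      (\<lambda>s. frechet_derivative f (at ?y) (s *\<^sub>R axis i 1))) (at t)"
    using f' by (rule has_derivative_compose [rotated, where f = "\<lambda>t. x + t *\<^sub>R axis i 1"])
      (auto intro!: derivative_eq_intros)
  moreover have "(\<lambda>s. frechet_derivative f (at ?y) (s *\<^sub>R axis i 1)) = (*) (partial i f ?y)"
    by (rule ext) (simp add: partial_def linear_scale [OF has_derivative_linear [OF f']] mult.commute)
  ultimately show ?thesis
    unfolding has_field_derivative_def by simp
qed

lemma C1_compact_partial_bounded:
  assumes "C1_compact i f" obtains M where "\<And>x. \<bar>partial i f x\<bar> \<le> M"
proof -
  obtain r where r: "\<And>x. norm x > r \<Longrightarrow> f x = 0" using C1_compact_support [OF assms] by blast
  have "compact (partial i f ` cball 0 r)"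
    using assms by (intro compact_continuous_image) (auto simp: C1_compact_def intro: continuous_on_subset)
  then obtain M where M: "\<And>x. norm x \<le> r \<Longrightarrow> \<bar>partial i f x\<bar> \<le> M"
    by (force dest: compact_imp_bounded simp: bounded_iff)
  have "\<bar>partial i f x\<bar> \<le> max M 0" for x
  proof (cases "norm x \<le> r")
    case False
    have "open {x::real^'a. norm x > r}" by (intro open_Collect_less continuous_intros)
    then have "partial i f x = 0"
      by (rule partial_eq_0) (use False r in auto)
    then show ?thesis by simp
  qed (use M in fastforce)
  then show thesis by (rule that)
qed

definition diff_quot :: "'d::finite \<Rightarrow> (real^'d \<Rightarrow> real) \<Rightarrow> real \<Rightarrow> real^'d \<Rightarrow> real" where
  "diff_quot i f t x = (f (x + t *\<^sub>R axis i 1) - f x) / t"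

lemma diff_quot_bounded:
  assumes "C1_compact i f" obtains M where "\<And>t x. \<bar>diff_quot i f t x\<bar> \<le> M"
proof -
  obtain M where M: "\<And>x. \<bar>partial i f x\<bar> \<le> M" using C1_compact_partial_bounded [OF assms] by blast
  have "\<bar>f (x + t *\<^sub>R axis i 1) - f (x + 0 *\<^sub>R axis i 1)\<bar> \<le> M * \<bar>t - 0\<bar>" for x t
    using field_differentiable_bound [of UNIV "\<lambda>t. f (x + t *\<^sub>R axis i 1)"
        "\<lambda>t. partial i f (x + t *\<^sub>R axis i 1)" M t 0] M C1_compact_partial_line [OF assms] by simp
  \<comment> \<open>At \<open>t = 0\<close> the quotient is 0 by the convention for division, and
    \<open>M [of x]\<close> supplies the inequality \<open>M \<ge> 0\<close> needed there.\<close>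
  then have "\<bar>diff_quot i f t x\<bar> \<le> M" for x t
    using M [of x] by (cases "t = 0") (auto simp: diff_quot_def abs_divide divide_le_eq)
  then show thesis by (rule that)
qed

lemma diff_quot_tendsto:
  assumes "C1_compact i f" and "h \<longlonglongrightarrow> 0" "\<And>n. h n \<noteq> 0"
  shows "(\<lambda>n. diff_quot i f (h n) x) \<longlonglongrightarrow> partial i f x"
proof -
  have "((\<lambda>t. f (x + t *\<^sub>R axis i 1)) has_real_derivative partial i f x) (at 0)"
    using C1_compact_partial_line [OF assms(1), of x 0] unfolding scaleR_zero_left add_0_right .
  then have "((\<lambda>t. diff_quot i f t x) \<longlongrightarrow> partial i f x) (at 0)"
    unfolding DERIV_def diff_quot_def scaleR_zero_left add_0_right add_0_left .
  moreover have "filterlim h (at 0) sequentially"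
    using assms(2,3) by (intro filterlim_atI always_eventually) auto
  ultimately show ?thesis by (rule filterlim_compose)
qed

lemma continuous_on_translate:
  fixes f :: "'a::real_normed_vector \<Rightarrow> 'b::topological_space"
  assumes "continuous_on UNIV f"
  shows "continuous_on UNIV (\<lambda>x. f (x + c))"
  by (rule continuous_on_compose2 [OF assms]) (intro continuous_intros, simp)

lemma diff_quot_continuous:
  assumes "continuous_on UNIV f"
  shows "continuous_on UNIV (diff_quot i f t)"
  unfolding diff_quot_def divide_inverse
  using continuous_on_translate [OF assms] assms
  by (intro continuous_on_mult continuous_on_diff continuous_on_const)

lemma diff_quot_eq_0:
  assumes "\<And>x. norm x > r \<Longrightarrow> f x = 0" "\<bar>t\<bar> \<le> 1" "norm x > r + 1"
  shows "diff_quot i f t x = 0"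
proof -
  have "norm (t *\<^sub>R axis i (1::real)) \<le> 1" using assms(2) by (simp add: norm_axis_1)
  then have "norm (x + t *\<^sub>R axis i 1) > r"
    using assms(3) norm_diff_ineq [of x "t *\<^sub>R axis i 1"] by linarith
  then show ?thesis using assms by (simp add: diff_quot_def)
qed

text \<open>Steps of size at most 1 keep the supports of all difference quotients in one ball, whose
  indicator times a constant is the integrable majorant for dominated convergence.\<close>

lemma obtain_null_sequence:
  obtains h :: "nat \<Rightarrow> real" where "h \<longlonglongrightarrow> 0" "\<And>n. h n \<noteq> 0" "\<And>n. \<bar>h n\<bar> \<le> 1"
proof
  show "(\<lambda>n. inverse (real (Suc n))) \<longlonglongrightarrow> 0" by (rule LIMSEQ_inverse_real_of_nat)
  show "inverse (real (Suc n)) \<noteq> 0" for n by simp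
  show "\<bar>inverse (real (Suc n))\<bar> \<le> 1" for n by (simp add: inverse_le_1_iff)
qed

text \<open>Every difference quotient has integral zero by translation invariance, and the partial
  derivative is their dominated limit.\<close>

lemma integral_partial_eq_0:
  assumes "C1_compact i f"
  shows "(LINT x|lborel. partial i f x) = 0"
proof -
  obtain h :: "nat \<Rightarrow> real" where h: "h \<longlonglongrightarrow> 0" "\<And>n. h n \<noteq> 0" "\<And>n. \<bar>h n\<bar> \<le> 1"
    using obtain_null_sequence by blast
  obtain r where r: "\<And>x. norm x > r \<Longrightarrow> f x = 0" using C1_compact_support [OF assms] by blast
  obtain M where M: "\<And>t x. \<bar>diff_quot i f t x\<bar> \<le> M" using diff_quot_bounded [OF assms] by blast
  note cont = C1_compact_continuous [OF assms]
  have int: "integrable lborel (\<lambda>x. f (x + c))" for c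
  proof (rule integrable_continuous_compact_support [OF continuous_on_translate [OF cont]])
    show "f (x + c) = 0" if "norm x > r + norm c" for x
      using that norm_diff_ineq [of x c] by (intro r) linarith
  qed
  have "(LINT x|lborel. diff_quot i f (h n) x) = 0" for n
    using int [of "h n *\<^sub>R axis i 1"] int [of 0] integral_lborel_translate [OF cont, of "h n *\<^sub>R axis i 1"]
    by (simp add: diff_quot_def)
  moreover have "(\<lambda>n. LINT x|lborel. diff_quot i f (h n) x) \<longlonglongrightarrow> (LINT x|lborel. partial i f x)"
  proof (rule integral_dominated_convergence)
    show "partial i f \<in> borel_measurable lborel"
      using assms by (auto simp: C1_compact_def intro: borel_measurable_continuous_onI)
    show "diff_quot i f (h n) \<in> borel_measurable lborel" for n
      using diff_quot_continuous [OF cont] by (auto intro: borel_measurable_continuous_onI)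
    show "integrable lborel (\<lambda>x. indicator (cball 0 (r + 1)) x *\<^sub>R M)"
      by (intro borel_integrable_compact) auto
    show "AE x in lborel. (\<lambda>n. diff_quot i f (h n) x) \<longlonglongrightarrow> partial i f x"
      using diff_quot_tendsto [OF assms h(1,2)] by simp
    show "AE x in lborel. norm (diff_quot i f (h n) x) \<le> indicator (cball 0 (r + 1)) x *\<^sub>R M" for n
      using M diff_quot_eq_0 [of r f "h n" _ i] r h(3) by (intro AE_I2) (auto simp: indicator_def not_le)
  qed
  ultimately show ?thesis by (simp add: LIMSEQ_const_iff)
qed

text \<open>
  Both sides are limits of integrals of products of difference quotients, which agree by translation
  invariance. No second derivatives are needed.
\<close>

lemma integral_partial_swap:
  assumes f: "C1_compact i f" "C1_compact j f" and g: "C1_compact i g" "C1_compact j g"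
  shows "(LINT x|lborel. partial i f x * partial j g x) = (LINT x|lborel. partial j f x * partial i g x)"
proof -
  obtain h :: "nat \<Rightarrow> real" where h: "h \<longlonglongrightarrow> 0" "\<And>n. h n \<noteq> 0" "\<And>n. \<bar>h n\<bar> \<le> 1"
    using obtain_null_sequence by blast
  have h': "(\<lambda>n. - h n) \<longlonglongrightarrow> 0" "\<And>n. - h n \<noteq> 0" "\<And>n. \<bar>- h n\<bar> \<le> 1"
    using h tendsto_minus [OF h(1)] by auto
  note cont = C1_compact_continuous [OF f(1)] C1_compact_continuous [OF g(1)]
  obtain r where r: "\<And>x. norm x > r \<Longrightarrow> f x = 0" using C1_compact_support [OF f(1)] by blast
  have lim: "(\<lambda>n. LINT x|lborel. diff_quot k f (s n) x * diff_quot l g (s n) x)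
      \<longlonglongrightarrow> (LINT x|lborel. partial k f x * partial l g x)"
    if fg: "C1_compact k f" "C1_compact l g" and s: "s \<longlonglongrightarrow> 0" "\<And>n. s n \<noteq> 0" "\<And>n. \<bar>s n\<bar> \<le> 1" for k l s
  proof -
    obtain M where M: "\<And>t x. \<bar>diff_quot k f t x\<bar> \<le> M" using diff_quot_bounded [OF fg(1)] by blast
    obtain N where N: "\<And>t x. \<bar>diff_quot l g t x\<bar> \<le> N" using diff_quot_bounded [OF fg(2)] by blast
    show ?thesis
    proof (rule integral_dominated_convergence)
      show "(\<lambda>x. partial k f x * partial l g x) \<in> borel_measurable lborel"
        using fg by (auto simp: C1_compact_def intro!: borel_measurable_continuous_onI continuous_intros)
      show "(\<lambda>x. diff_quot k f (s n) x * diff_quot l g (s n) x) \<in> borel_measurable lborel" for n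
        using diff_quot_continuous cont
        by (auto intro!: borel_measurable_continuous_onI continuous_on_mult)
      show "integrable lborel (\<lambda>x. indicator (cball 0 (r + 1)) x *\<^sub>R (M * N))"
        by (intro borel_integrable_compact) auto
      show "AE x in lborel. (\<lambda>n. diff_quot k f (s n) x * diff_quot l g (s n) x)
          \<longlonglongrightarrow> partial k f x * partial l g x"
        using diff_quot_tendsto [OF fg(1) s(1,2)] diff_quot_tendsto [OF fg(2) s(1,2)]
        by (intro AE_I2 tendsto_mult)
      have "\<bar>diff_quot k f t x * diff_quot l g t x\<bar> \<le> M * N" for t x
        unfolding abs_mult using M [of t x] N [of t x] by (intro mult_mono) auto
      then show "AE x in lborel. norm (diff_quot k f (s n) x * diff_quot l g (s n) x)
          \<le> indicator (cball 0 (r + 1)) x *\<^sub>R (M * N)" for n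
        using diff_quot_eq_0 [of r f "s n" _ k] r s(3) by (intro AE_I2) (auto simp: indicator_def not_le)
    qed
  qed
  define I where "I a b = (LINT x|lborel. f (x + a) * g (x + b))" for a b
  have cont': "continuous_on UNIV (\<lambda>x. f (x + a) * g (x + b))" for a b
    using continuous_on_translate [OF cont(1)] continuous_on_translate [OF cont(2)]
    by (rule continuous_on_mult)
  have int: "integrable lborel (\<lambda>x. f (x + a) * g (x + b))" for a b
  proof (rule integrable_continuous_compact_support [OF cont'])
    show "f (x + a) * g (x + b) = 0" if "norm x > r + norm a" for x
      using that norm_diff_ineq [of x a] r [of "x + a"] by auto
  qed
  have I: "I (a + c) (b + c) = I a b" for a b c
    using integral_lborel_translate [OF cont' [of a b], of c] by (simp add: I_def add_ac)
  have dq: "(LINT x|lborel. diff_quot k f t x * diff_quot l g t x) =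
      (I (t *\<^sub>R axis k 1) (t *\<^sub>R axis l 1) - I (t *\<^sub>R axis k 1) 0 - I 0 (t *\<^sub>R axis l 1) + I 0 0) / (t * t)" for k l t
  proof -
    have "(LINT x|lborel. diff_quot k f t x * diff_quot l g t x) =
      (LINT x|lborel. (f (x + t *\<^sub>R axis k 1) * g (x + t *\<^sub>R axis l 1) - f (x + t *\<^sub>R axis k 1) * g (x + 0)
         - f (x + 0) * g (x + t *\<^sub>R axis l 1) + f (x + 0) * g (x + 0)) / (t * t))"
      by (rule Bochner_Integration.integral_cong)
        (simp_all add: diff_quot_def algebra_simps add_divide_distrib diff_divide_distrib)
    also have "\<dots> = (I (t *\<^sub>R axis k 1) (t *\<^sub>R axis l 1) - I (t *\<^sub>R axis k 1) 0 - I 0 (t *\<^sub>R axis l 1) + I 0 0) / (t * t)"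
      unfolding I_def integral_divide_zero
      by (subst Bochner_Integration.integral_add Bochner_Integration.integral_diff;
          (intro Bochner_Integration.integrable_diff int)?)+ simp
    finally show ?thesis .
  qed
  \<comment> \<open>Translation by \<open>- h (e_i + e_j)\<close> carries the offsets
    \<open>(h e_i, h e_j)\<close> to \<open>(- h e_j, - h e_i)\<close>: exchanging the two
    directions reverses the step. The two mixed terms are matched by translations along a single
    axis.\<close>
  have "(LINT x|lborel. diff_quot i f (h n) x * diff_quot j g (h n) x) =
    (LINT x|lborel. diff_quot j f (- h n) x * diff_quot i g (- h n) x)" for n
    using I [of "- h n *\<^sub>R axis j 1" "h n *\<^sub>R axis j 1 + h n *\<^sub>R axis i 1" "- h n *\<^sub>R axis i 1"]
      I [of "- h n *\<^sub>R axis j 1" "h n *\<^sub>R axis j 1" 0] I [of 0 "h n *\<^sub>R axis i 1" "- h n *\<^sub>R axis i 1"]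
    unfolding dq by simp
  then show ?thesis
    using LIMSEQ_unique [OF lim [OF f(1) g(2) h]] lim [OF f(2) g(1) h'] by simp
qed

section \<open>Square integrable functions\<close>

lemma borel_measurable_lebesgue_on_continuous:
  fixes f :: "'a::euclidean_space \<Rightarrow> real"
  assumes "continuous_on UNIV f"
  shows "f \<in> borel_measurable (lebesgue_on \<Omega>)"
  using borel_measurable_continuous_onI [OF assms]
  by (intro measurable_restrict_space1 measurable_completion) simp

lemma integral_lebesgue_on_eq_lborel:
  fixes f :: "'a::euclidean_space \<Rightarrow> real"
  assumes "open \<Omega>" and "continuous_on UNIV f" and "\<And>x. x \<notin> \<Omega> \<Longrightarrow> f x = 0"
  shows "(LINT x|lebesgue_on \<Omega>. f x) = (LINT x|lborel. f x)"
proof -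
  have "(\<lambda>x. indicator \<Omega> x *\<^sub>R f x) = f"
    using assms(3) by (auto simp: indicator_def fun_eq_iff)
  moreover have "f \<in> borel_measurable lborel"
    using borel_measurable_continuous_onI [OF assms(2)] by simp
  ultimately show ?thesis
    using assms(1) by (simp add: integral_restrict_space integral_completion)
qed

lemma abs_mult_le_squares: "\<bar>a * b\<bar> \<le> a\<^sup>2 + b\<^sup>2" for a b :: real
proof -
  have "2 * (\<bar>a\<bar> * \<bar>b\<bar>) \<le> a\<^sup>2 + b\<^sup>2"
    using sum_squares_bound [of "\<bar>a\<bar>" "\<bar>b\<bar>"] by (simp add: mult.assoc)
  moreover have "0 \<le> \<bar>a\<bar> * \<bar>b\<bar>" by simp
  ultimately show ?thesis unfolding abs_mult by linarith
qed

lemma L2_mult: "f \<in> L2 \<Omega> \<Longrightarrow> g \<in> L2 \<Omega> \<Longrightarrow> integrable (lebesgue_on \<Omega>) (\<lambda>x. f x * g x)"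
  unfolding L2_def
proof (clarsimp, rule Bochner_Integration.integrable_bound)
  assume "integrable (lebesgue_on \<Omega>) (\<lambda>x. (f x)\<^sup>2)" "integrable (lebesgue_on \<Omega>) (\<lambda>x. (g x)\<^sup>2)"
  then show "integrable (lebesgue_on \<Omega>) (\<lambda>x. (f x)\<^sup>2 + (g x)\<^sup>2)" by simp
  show "AE x in lebesgue_on \<Omega>. norm (f x * g x) \<le> norm ((f x)\<^sup>2 + (g x)\<^sup>2)"
    using abs_mult_le_squares by (intro AE_I2) simp
qed auto

lemma L2_square: "f \<in> L2 \<Omega> \<Longrightarrow> integrable (lebesgue_on \<Omega>) (\<lambda>x. (f x)\<^sup>2)"
  by (simp add: L2_def)

lemma L2_add:
  assumes "f \<in> L2 \<Omega>" "g \<in> L2 \<Omega>"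
  shows "(\<lambda>x. f x + g x) \<in> L2 \<Omega>"
proof -
  have "integrable (lebesgue_on \<Omega>) (\<lambda>x. (f x)\<^sup>2 + 2 * (f x * g x) + (g x)\<^sup>2)"
    using L2_mult [OF assms] assms by (simp add: L2_def)
  moreover have "(\<lambda>x. (f x)\<^sup>2 + 2 * (f x * g x) + (g x)\<^sup>2) = (\<lambda>x. (f x + g x)\<^sup>2)"
    by (simp add: power2_sum fun_eq_iff)
  ultimately show ?thesis using assms by (auto simp: L2_def)
qed

lemma L2_scale: "f \<in> L2 \<Omega> \<Longrightarrow> (\<lambda>x. c * f x) \<in> L2 \<Omega>"
  by (auto simp: L2_def power_mult_distrib)

lemma L2_diff: "f \<in> L2 \<Omega> \<Longrightarrow> g \<in> L2 \<Omega> \<Longrightarrow> (\<lambda>x. f x - g x) \<in> L2 \<Omega>"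
  using L2_add [of f \<Omega> "\<lambda>x. - 1 * g x"] L2_scale [of g \<Omega> "- 1"] by simp

lemma L2_sum: "(\<And>i. i \<in> I \<Longrightarrow> f i \<in> L2 \<Omega>) \<Longrightarrow> (\<lambda>x. \<Sum>i\<in>I. f i x) \<in> L2 \<Omega>"
proof (induction I rule: infinite_finite_induct)
  case (insert i I)
  then show ?case using L2_add [of "f i" \<Omega> "\<lambda>x. \<Sum>i\<in>I. f i x"] by simp
qed (simp_all add: L2_def)

lemma L2_bounded_mult:
  assumes "w \<in> borel_measurable (lebesgue_on \<Omega>)" "\<And>x. \<bar>w x\<bar> \<le> M" "f \<in> L2 \<Omega>"
  shows "(\<lambda>x. w x * f x) \<in> L2 \<Omega>"
proof -
  have "integrable (lebesgue_on \<Omega>) (\<lambda>x. (w x * f x)\<^sup>2)"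
  proof (rule Bochner_Integration.integrable_bound)
    show "integrable (lebesgue_on \<Omega>) (\<lambda>x. M\<^sup>2 * (f x)\<^sup>2)"
      using assms(3) by (simp add: L2_def)
    have "(w x)\<^sup>2 \<le> M\<^sup>2" for x
      using assms(2) [of x] by (metis abs_ge_zero power2_abs power_mono)
    then show "AE x in lebesgue_on \<Omega>. norm ((w x * f x)\<^sup>2) \<le> norm (M\<^sup>2 * (f x)\<^sup>2)"
      by (intro AE_I2) (simp add: power_mult_distrib mult_right_mono)
  qed (use assms in \<open>auto simp: L2_def\<close>)
  then show ?thesis using assms by (auto simp: L2_def)
qed

lemma L2_continuous_compact_support:
  assumes "open \<Omega>" "continuous_on UNIV f" "\<And>x. norm x > r \<Longrightarrow> f x = 0"
  shows "f \<in> L2 \<Omega>"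
proof -
  have cont: "continuous_on UNIV (\<lambda>x. (f x)\<^sup>2)"
    using assms(2) by (intro continuous_intros)
  have "integrable lborel (\<lambda>x. (f x)\<^sup>2)"
    by (rule integrable_continuous_compact_support [OF cont, of r]) (simp add: assms(3))
  then have "integrable lebesgue (\<lambda>x. (f x)\<^sup>2)"
    using borel_measurable_continuous_onI [OF cont] by (simp add: integrable_completion)
  then have "integrable (lebesgue_on \<Omega>) (\<lambda>x. (f x)\<^sup>2)"
    using integrable_mult_indicator [of \<Omega> lebesgue "\<lambda>x. (f x)\<^sup>2"] assms(1)
    by (simp add: integrable_restrict_space)
  then show ?thesis
    using borel_measurable_lebesgue_on_continuous [OF assms(2)] by (simp add: L2_def)
qed

text \<open>This is Young's inequality with weight \<open>s\<close>, in a form that tends to zero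
  with \<open>s\<close> for fixed \<open>f\<close>. As \<open>s\<close> is any positive bound for
  the norm of \<open>g\<close>, the case of norm zero is included.\<close>

lemma integral_product_bound:
  assumes f: "f \<in> L2 \<Omega>" and g: "g \<in> L2 \<Omega>" and s: "s > 0" "(LINT x|lebesgue_on \<Omega>. (g x)\<^sup>2) \<le> s\<^sup>2"
  shows "\<bar>LINT x|lebesgue_on \<Omega>. f x * g x\<bar> \<le> s * ((LINT x|lebesgue_on \<Omega>. (f x)\<^sup>2) + 1) / 2"
proof -
  have "\<bar>LINT x|lebesgue_on \<Omega>. f x * g x\<bar> \<le> (LINT x|lebesgue_on \<Omega>. \<bar>f x * g x\<bar>)"
    using integral_norm_bound [of "lebesgue_on \<Omega>" "\<lambda>x. f x * g x"] by simp
  also have "\<dots> \<le> (LINT x|lebesgue_on \<Omega>. s / 2 * (f x)\<^sup>2 + 1 / (2 * s) * (g x)\<^sup>2)"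
  proof (rule integral_mono)
    fix x
    have "0 \<le> (s * \<bar>f x\<bar> - \<bar>g x\<bar>)\<^sup>2" by simp
    then have "2 * s * \<bar>f x * g x\<bar> \<le> s\<^sup>2 * (f x)\<^sup>2 + (g x)\<^sup>2"
      by (simp add: power2_diff power_mult_distrib abs_mult mult_ac)
    then show "\<bar>f x * g x\<bar> \<le> s / 2 * (f x)\<^sup>2 + 1 / (2 * s) * (g x)\<^sup>2"
      using s(1) by (simp add: field_simps power2_eq_square)
  qed (use L2_mult [OF f g] L2_square [OF f] L2_square [OF g] in simp_all)
  also have "\<dots> = s / 2 * (LINT x|lebesgue_on \<Omega>. (f x)\<^sup>2) + 1 / (2 * s) * (LINT x|lebesgue_on \<Omega>. (g x)\<^sup>2)"
    using L2_square [OF f] L2_square [OF g] by simp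
  also have "\<dots> \<le> s / 2 * (LINT x|lebesgue_on \<Omega>. (f x)\<^sup>2) + 1 / (2 * s) * s\<^sup>2"
    using s by (intro add_left_mono mult_left_mono) auto
  also have "\<dots> = s * ((LINT x|lebesgue_on \<Omega>. (f x)\<^sup>2) + 1) / 2"
    using s(1) by (simp add: field_simps power2_eq_square)
  finally show ?thesis .
qed

text \<open>Membership in \<open>L2\<close> is part of the notion because the Bochner integral of a
  non-integrable function is 0, so that convergence of the integrals alone would carry no
  information.\<close>

definition L2_tendsto :: "(real^'d::finite) set \<Rightarrow> (nat \<Rightarrow> real^'d \<Rightarrow> real) \<Rightarrow> (real^'d \<Rightarrow> real) \<Rightarrow> bool" where
  "L2_tendsto \<Omega> F f \<longleftrightarrow> (\<forall>n. F n \<in> L2 \<Omega>) \<and> f \<in> L2 \<Omega> \<and>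
     (\<lambda>n. LINT x|lebesgue_on \<Omega>. (F n x - f x)\<^sup>2) \<longlonglongrightarrow> 0"

lemma integral_L2_null:
  assumes f: "f \<in> L2 \<Omega>" and d: "\<And>n. d n \<in> L2 \<Omega>" "(\<lambda>n. LINT x|lebesgue_on \<Omega>. (d n x)\<^sup>2) \<longlonglongrightarrow> 0"
  shows "(\<lambda>n. LINT x|lebesgue_on \<Omega>. f x * d n x) \<longlonglongrightarrow> 0"
proof -
  define D where "D n = (LINT x|lebesgue_on \<Omega>. (d n x)\<^sup>2)" for n
  \<comment> \<open>The second summand keeps \<open>s n\<close> positive when \<open>d n\<close> has
    norm zero, and it tends to zero as well.\<close>
  define s where "s n = sqrt (D n) + inverse (real (Suc n))" for n
  define c where "c = ((LINT x|lebesgue_on \<Omega>. (f x)\<^sup>2) + 1) / 2"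
  have D: "D n \<ge> 0" for n by (simp add: D_def)
  have "s \<longlonglongrightarrow> sqrt 0 + 0"
    unfolding s_def by (intro tendsto_add tendsto_real_sqrt LIMSEQ_inverse_real_of_nat d(2) [folded D_def])
  then have lim: "(\<lambda>n. s n * c) \<longlonglongrightarrow> 0"
    using tendsto_mult_right [of s 0 sequentially c] by simp
  have "norm (LINT x|lebesgue_on \<Omega>. f x * d n x) \<le> s n * c" for n
  proof -
    have "s n > 0" using D [of n] by (simp add: s_def add_nonneg_pos)
    moreover have "D n \<le> (s n)\<^sup>2"
      using D [of n] power_mono [of "sqrt (D n)" "s n" 2] by (simp add: s_def)
    ultimately show ?thesis
      using integral_product_bound [OF f d(1)] by (simp add: D_def c_def)
  qed
  then have "\<forall>\<^sub>F n in sequentially. norm (LINT x|lebesgue_on \<Omega>. f x * d n x) \<le> s n * c"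
    by simp
  then show ?thesis using lim by (rule Lim_null_comparison)
qed

text \<open>The product \<open>F G\<close> is expanded around \<open>f g\<close>. The two terms
  linear in the errors vanish by \<open>integral_L2_null\<close>, and the product of the errors is
  dominated by the sum of their squares.\<close>

lemma L2_tendsto_inner:
  assumes F: "L2_tendsto \<Omega> F f" and G: "L2_tendsto \<Omega> G g"
  shows "(\<lambda>n. LINT x|lebesgue_on \<Omega>. F n x * G n x) \<longlonglongrightarrow> (LINT x|lebesgue_on \<Omega>. f x * g x)"
proof -
  note fg = F [unfolded L2_tendsto_def] G [unfolded L2_tendsto_def]
  have dF: "(\<lambda>x. F n x - f x) \<in> L2 \<Omega>" and dG: "(\<lambda>x. G n x - g x) \<in> L2 \<Omega>" for n
    using fg by (auto intro: L2_diff)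
  have 1: "(\<lambda>n. LINT x|lebesgue_on \<Omega>. f x * (G n x - g x)) \<longlonglongrightarrow> 0"
    by (rule integral_L2_null) (use fg dG in auto)
  have 2: "(\<lambda>n. LINT x|lebesgue_on \<Omega>. g x * (F n x - f x)) \<longlonglongrightarrow> 0"
    by (rule integral_L2_null) (use fg dF in auto)
  have 3: "(\<lambda>n. LINT x|lebesgue_on \<Omega>. (F n x - f x) * (G n x - g x)) \<longlonglongrightarrow> 0"
  proof (rule Lim_null_comparison)
    show "(\<lambda>n. (LINT x|lebesgue_on \<Omega>. (F n x - f x)\<^sup>2) + (LINT x|lebesgue_on \<Omega>. (G n x - g x)\<^sup>2)) \<longlonglongrightarrow> 0"
      using tendsto_add [of _ 0 sequentially _ 0] fg by auto
    have "norm (LINT x|lebesgue_on \<Omega>. (F n x - f x) * (G n x - g x)) \<le>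
        (LINT x|lebesgue_on \<Omega>. (F n x - f x)\<^sup>2) + (LINT x|lebesgue_on \<Omega>. (G n x - g x)\<^sup>2)" for n
    proof -
      have "norm (LINT x|lebesgue_on \<Omega>. (F n x - f x) * (G n x - g x)) \<le>
          (LINT x|lebesgue_on \<Omega>. norm ((F n x - f x) * (G n x - g x)))"
        by (rule integral_norm_bound)
      also have "\<dots> \<le> (LINT x|lebesgue_on \<Omega>. (F n x - f x)\<^sup>2 + (G n x - g x)\<^sup>2)"
      proof (rule integral_mono)
        show "norm ((F n x - f x) * (G n x - g x)) \<le> (F n x - f x)\<^sup>2 + (G n x - g x)\<^sup>2" for x
          using abs_mult_le_squares by simp
      qed (use L2_mult [OF dF dG] L2_square [OF dF] L2_square [OF dG] in simp_all)
      finally show ?thesis using L2_square [OF dF] L2_square [OF dG] by simp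
    qed
    then show "\<forall>\<^sub>F n in sequentially. norm (LINT x|lebesgue_on \<Omega>. (F n x - f x) * (G n x - g x)) \<le>
        (LINT x|lebesgue_on \<Omega>. (F n x - f x)\<^sup>2) + (LINT x|lebesgue_on \<Omega>. (G n x - g x)\<^sup>2)" by simp
  qed
  have "(LINT x|lebesgue_on \<Omega>. F n x * G n x) = (LINT x|lebesgue_on \<Omega>. f x * g x) +
     (LINT x|lebesgue_on \<Omega>. f x * (G n x - g x)) + (LINT x|lebesgue_on \<Omega>. g x * (F n x - f x)) +
     (LINT x|lebesgue_on \<Omega>. (F n x - f x) * (G n x - g x))" (is "_ = ?r") for n
  proof -
    have int: "integrable (lebesgue_on \<Omega>) (\<lambda>x. f x * g x)"
      "integrable (lebesgue_on \<Omega>) (\<lambda>x. f x * (G n x - g x))"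
      "integrable (lebesgue_on \<Omega>) (\<lambda>x. g x * (F n x - f x))"
      "integrable (lebesgue_on \<Omega>) (\<lambda>x. (F n x - f x) * (G n x - g x))"
      using fg dF dG by (auto intro: L2_mult)
    have "?r = (LINT x|lebesgue_on \<Omega>. f x * g x + f x * (G n x - g x) + g x * (F n x - f x)
        + (F n x - f x) * (G n x - g x))"
      by (simp only: Bochner_Integration.integral_add Bochner_Integration.integrable_add int)
    also have "\<dots> = (LINT x|lebesgue_on \<Omega>. F n x * G n x)"
      by (simp add: algebra_simps)
    finally show ?thesis by simp
  qed
  then show ?thesis
    using tendsto_add [OF tendsto_add [OF tendsto_add [OF tendsto_const 1] 2] 3, of "LINT x|lebesgue_on \<Omega>. f x * g x"]
    by simp
qed

lemma L2_tendsto_bounded_mult: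
  assumes w: "w \<in> borel_measurable (lebesgue_on \<Omega>)" "\<And>x. \<bar>w x\<bar> \<le> M" and F: "L2_tendsto \<Omega> F f"
  shows "L2_tendsto \<Omega> (\<lambda>n x. w x * F n x) (\<lambda>x. w x * f x)"
proof -
  note F = F [unfolded L2_tendsto_def]
  have "(\<lambda>n. LINT x|lebesgue_on \<Omega>. (w x * F n x - w x * f x)\<^sup>2) \<longlonglongrightarrow> 0"
  proof (rule Lim_null_comparison)
    show "(\<lambda>n. M\<^sup>2 * (LINT x|lebesgue_on \<Omega>. (F n x - f x)\<^sup>2)) \<longlonglongrightarrow> 0"
      using F tendsto_mult_right_zero by blast
    have wM: "(w x)\<^sup>2 \<le> M\<^sup>2" for x
      using w(2) [of x] by (metis abs_ge_zero power2_abs power_mono)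
    have "norm (LINT x|lebesgue_on \<Omega>. (w x * F n x - w x * f x)\<^sup>2) \<le> M\<^sup>2 * (LINT x|lebesgue_on \<Omega>. (F n x - f x)\<^sup>2)" for n
    proof -
      have d: "(\<lambda>x. F n x - f x) \<in> L2 \<Omega>" using F by (auto intro: L2_diff)
      have "(LINT x|lebesgue_on \<Omega>. (w x * F n x - w x * f x)\<^sup>2) \<le> (LINT x|lebesgue_on \<Omega>. M\<^sup>2 * (F n x - f x)\<^sup>2)"
      proof (rule integral_mono)
        show "integrable (lebesgue_on \<Omega>) (\<lambda>x. (w x * F n x - w x * f x)\<^sup>2)"
          using L2_square [OF L2_bounded_mult [OF w d]] by (simp add: right_diff_distrib)
        show "(w x * F n x - w x * f x)\<^sup>2 \<le> M\<^sup>2 * (F n x - f x)\<^sup>2" for x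
          using wM [of x] by (simp add: power_mult_distrib mult_right_mono flip: right_diff_distrib)
      qed (use L2_square [OF d] in simp)
      then show ?thesis by simp
    qed
    then show "\<forall>\<^sub>F n in sequentially. norm (LINT x|lebesgue_on \<Omega>. (w x * F n x - w x * f x)\<^sup>2) \<le>
        M\<^sup>2 * (LINT x|lebesgue_on \<Omega>. (F n x - f x)\<^sup>2)" by simp
  qed
  then show ?thesis
    using F L2_bounded_mult [OF w] by (simp add: L2_tendsto_def)
qed

section \<open>Test functions and Sobolev functions\<close>

lemma test_function_C1_compact:
  assumes "test_function \<Omega> \<phi>" shows "C1_compact i \<phi>"
proof -
  have "C_k (Suc 0) \<phi>" using assms unfolding test_function_def by blast
  moreover have "\<exists>r. \<forall>x. norm x > r \<longrightarrow> \<phi> x = 0"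
  proof -
    have "bounded (closure {x. \<phi> x \<noteq> 0})"
      using assms by (simp add: test_function_def compact_imp_bounded)
    then obtain r where "\<And>x. x \<in> closure {x. \<phi> x \<noteq> 0} \<Longrightarrow> norm x \<le> r"
      by (auto simp: bounded_iff)
    then show ?thesis using closure_subset [of "{x. \<phi> x \<noteq> 0}"] by (force simp: not_le [symmetric])
  qed
  ultimately show ?thesis by (simp add: C1_compact_def differentiable_on_def)
qed

lemma test_function_eq_0:
  assumes "test_function \<Omega> \<phi>" "x \<notin> \<Omega>" shows "\<phi> x = 0" "partial i \<phi> x = 0"
proof -
  \<comment> \<open>The complement of the support is open, so \<open>\<phi>\<close> vanishes in a
    whole neighbourhood of \<open>x\<close> and its derivative vanishes with it.\<close>
  have x: "x \<in> - closure {x. \<phi> x \<noteq> 0}" using assms by (auto simp: test_function_def)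
  then show "\<phi> x = 0" using closure_subset [of "{x. \<phi> x \<noteq> 0}"] by auto
  show "partial i \<phi> x = 0"
    by (rule partial_eq_0 [OF _ x]) (use closure_subset [of "{x. \<phi> x \<noteq> 0}"] in auto)
qed

lemma test_function_L2:
  assumes "open \<Omega>" "test_function \<Omega> \<phi>" shows "\<phi> \<in> L2 \<Omega>" "partial i \<phi> \<in> L2 \<Omega>"
proof -
  note C1_compact = test_function_C1_compact [OF assms(2)]
  obtain r where r: "\<And>x. norm x > r \<Longrightarrow> \<phi> x = 0" using C1_compact_support [OF C1_compact] by blast
  show "\<phi> \<in> L2 \<Omega>"
    using L2_continuous_compact_support [OF assms(1) C1_compact_continuous [OF C1_compact] r] by blast
  have "partial i \<phi> x = 0" if "norm x > r" for x
  proof (rule partial_eq_0)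
    show "open {x::real^'a. norm x > r}" by (intro open_Collect_less continuous_intros)
  qed (use that r in auto)
  moreover have "continuous_on UNIV (partial i \<phi>)" using C1_compact [of i] by (simp add: C1_compact_def)
  ultimately show "partial i \<phi> \<in> L2 \<Omega>"
    using L2_continuous_compact_support [OF assms(1)] by blast
qed

section \<open>Approximation of Sobolev functions by test functions\<close>

lemma H1_L2: "f \<in> H1 \<Omega> \<Longrightarrow> f \<in> L2 \<Omega>"
  by (simp add: H1_def)

lemma weak_partial_L2:
  assumes "f \<in> H1 \<Omega>" shows "weak_partial \<Omega> i f \<in> L2 \<Omega>"
proof -
  have "\<exists>g. has_weak_partial \<Omega> i f g" using assms by (simp add: H1_def)
  then have "has_weak_partial \<Omega> i f (weak_partial \<Omega> i f)"
    unfolding weak_partial_def by (rule someI_ex)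
  then show ?thesis by (simp add: has_weak_partial_def)
qed

lemma H1_0_approx:
  assumes "open \<Omega>" "f \<in> H1_0 \<Omega>"
  obtains \<phi> where "\<And>n. test_function \<Omega> (\<phi> n)" "L2_tendsto \<Omega> \<phi> f"
    "\<And>i. L2_tendsto \<Omega> (\<lambda>n. partial i (\<phi> n)) (weak_partial \<Omega> i f)"
proof -
  obtain \<phi> where \<phi>: "\<And>n. test_function \<Omega> (\<phi> n)" and
    lim: "(\<lambda>n. (LINT x|lebesgue_on \<Omega>. (\<phi> n x - f x)\<^sup>2) +
           (\<Sum>i\<in>UNIV. LINT x|lebesgue_on \<Omega>. (partial i (\<phi> n) x - weak_partial \<Omega> i f x)\<^sup>2))
       \<longlonglongrightarrow> 0" (is "?L \<longlonglongrightarrow> 0")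
    using assms(2) by (auto simp: H1_0_def)
  have f: "f \<in> H1 \<Omega>" using assms(2) by (simp add: H1_0_def)
  have "(\<lambda>n. LINT x|lebesgue_on \<Omega>. (\<phi> n x - f x)\<^sup>2) \<longlonglongrightarrow> 0"
    by (rule Lim_null_comparison [OF _ lim]) (simp add: sum_nonneg)
  moreover have "(\<lambda>n. LINT x|lebesgue_on \<Omega>. (partial i (\<phi> n) x - weak_partial \<Omega> i f x)\<^sup>2) \<longlonglongrightarrow> 0" for i
  proof (rule Lim_null_comparison [OF _ lim])
    have "norm (LINT x|lebesgue_on \<Omega>. (partial i (\<phi> n) x - weak_partial \<Omega> i f x)\<^sup>2) \<le> ?L n" for n
      using member_le_sum [of i UNIV "\<lambda>i. LINT x|lebesgue_on \<Omega>. (partial i (\<phi> n) x - weak_partial \<Omega> i f x)\<^sup>2"]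
      by (simp add: add_increasing)
    then show "\<forall>\<^sub>F n in sequentially.
        norm (LINT x|lebesgue_on \<Omega>. (partial i (\<phi> n) x - weak_partial \<Omega> i f x)\<^sup>2) \<le> ?L n" by simp
  qed
  ultimately show thesis
    using that [OF \<phi>] test_function_L2 [OF assms(1) \<phi>] H1_L2 [OF f] weak_partial_L2 [OF f]
    by (simp add: L2_tendsto_def)
qed

text \<open>Integrals of test functions over \<Omega> extend to the whole space, where
  \<open>integral_partial_swap\<close> applies; convergence in \<open>L2\<close> transfers the
  identity to \<open>f\<close> and \<open>g\<close>. Applied to components of two velocities, it
  exchanges the summands of \<nabla>u : (\<nabla>v)^T with those of div u div v.\<close>

lemma H1_0_integral_swap:
  assumes \<Omega>: "open \<Omega>" and f: "f \<in> H1_0 \<Omega>" and g: "g \<in> H1_0 \<Omega>"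
  shows "(LINT x|lebesgue_on \<Omega>. weak_partial \<Omega> i f x * weak_partial \<Omega> j g x) =
    (LINT x|lebesgue_on \<Omega>. weak_partial \<Omega> j f x * weak_partial \<Omega> i g x)"
proof -
  obtain \<phi> where \<phi>: "\<And>n. test_function \<Omega> (\<phi> n)" "\<And>i. L2_tendsto \<Omega> (\<lambda>n. partial i (\<phi> n)) (weak_partial \<Omega> i f)"
    using H1_0_approx [OF \<Omega> f] by metis
  obtain \<psi> where \<psi>: "\<And>n. test_function \<Omega> (\<psi> n)" "\<And>i. L2_tendsto \<Omega> (\<lambda>n. partial i (\<psi> n)) (weak_partial \<Omega> i g)"
    using H1_0_approx [OF \<Omega> g] by metis
  have eq: "(LINT x|lebesgue_on \<Omega>. partial i (\<phi> n) x * partial j (\<psi> n) x) =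
      (LINT x|lborel. partial i (\<phi> n) x * partial j (\<psi> n) x)" for i j n
    using test_function_C1_compact [OF \<phi>(1), of i n] test_function_C1_compact [OF \<psi>(1), of j n]
      test_function_eq_0 [OF \<phi>(1)]
    by (intro integral_lebesgue_on_eq_lborel \<Omega>) (auto simp: C1_compact_def intro: continuous_on_mult)
  have "(LINT x|lebesgue_on \<Omega>. partial i (\<phi> n) x * partial j (\<psi> n) x) =
      (LINT x|lebesgue_on \<Omega>. partial j (\<phi> n) x * partial i (\<psi> n) x)" for n
    unfolding eq by (intro integral_partial_swap test_function_C1_compact [OF \<phi>(1)] test_function_C1_compact [OF \<psi>(1)])
  then show ?thesis
    using LIMSEQ_unique [OF L2_tendsto_inner [OF \<phi>(2) \<psi>(2)]] L2_tendsto_inner [OF \<phi>(2) \<psi>(2)] by simp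
qed

text \<open>The arctangent is bounded and so is its derivative, which is moreover positive. The
  terms are bracketed as a function times a bounded weight times another function, the shape to
  which the \<open>L2\<close> lemmas apply.\<close>

lemma partial_arctan_mult:
  assumes f: "C1_compact j f" and g: "C1_compact j g"
  shows "C1_compact j (\<lambda>x. arctan (x $ j) * (f x * g x))"
    and "partial j (\<lambda>x. arctan (x $ j) * (f x * g x)) =
      (\<lambda>x. f x * (inverse (1 + (x $ j)\<^sup>2) * g x) + f x * (arctan (x $ j) * partial j g x) + g x * (arctan (x $ j) * partial j f x))"
proof -
  have der: "((\<lambda>x. arctan (x $ j) * (f x * g x)) has_derivative
      (\<lambda>v. arctan (x $ j) * (f x * frechet_derivative g (at x) v + frechet_derivative f (at x) v * g x)
         + inverse (1 + (x $ j)\<^sup>2) * (v $ j) * (f x * g x))) (at x)" for x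
  proof -
    have f': "(f has_derivative frechet_derivative f (at x)) (at x)"
      and g': "(g has_derivative frechet_derivative g (at x)) (at x)"
      using f g by (simp_all add: C1_compact_def flip: frechet_derivative_works)
    have vec: "((\<lambda>x. x $ j) has_derivative (\<lambda>v. v $ j)) (at x)"
      by (rule bounded_linear.has_derivative [OF bounded_linear_vec_nth has_derivative_ident])
    have "((\<lambda>x. arctan (x $ j)) has_derivative (\<lambda>v. inverse (1 + (x $ j)\<^sup>2) * (v $ j))) (at x)"
      by (rule has_derivative_compose [OF vec, of arctan "(*) (inverse (1 + (x $ j)\<^sup>2))"])
        (rule DERIV_arctan [THEN has_field_derivative_imp_has_derivative])
    from has_derivative_mult [OF this has_derivative_mult [OF f' g']] show ?thesis .
  qed
  show eq: "partial j (\<lambda>x. arctan (x $ j) * (f x * g x)) =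
      (\<lambda>x. f x * (inverse (1 + (x $ j)\<^sup>2) * g x) + f x * (arctan (x $ j) * partial j g x) + g x * (arctan (x $ j) * partial j f x))"
    by (rule ext, subst partialI [OF der]) (simp add: partial_def algebra_simps)
  have "\<exists>r. \<forall>x. norm x > r \<longrightarrow> arctan (x $ j) * (f x * g x) = 0"
    using f by (auto simp: C1_compact_def)
  moreover have "continuous_on UNIV (partial j (\<lambda>x. arctan (x $ j) * (f x * g x)))"
    unfolding eq using C1_compact_continuous [OF f] C1_compact_continuous [OF g] f g
    by (intro continuous_intros) (auto simp: C1_compact_def add_nonneg_eq_0_iff)
  ultimately show "C1_compact j (\<lambda>x. arctan (x $ j) * (f x * g x))"
    using der by (auto simp: C1_compact_def differentiable_def)
qed

text \<open>
  A substitute for the Poincare inequality that also works on unbounded domains.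
\<close>

lemma H1_0_integral_weight:
  fixes \<Omega> :: "(real^'d::finite) set"
  assumes \<Omega>: "open \<Omega>" and f: "f \<in> H1_0 \<Omega>" and g: "g \<in> H1_0 \<Omega>"
  shows "(LINT x|lebesgue_on \<Omega>. f x * (inverse (1 + (x $ j)\<^sup>2) * g x)) +
    (LINT x|lebesgue_on \<Omega>. f x * (arctan (x $ j) * weak_partial \<Omega> j g x)) +
    (LINT x|lebesgue_on \<Omega>. g x * (arctan (x $ j) * weak_partial \<Omega> j f x)) = 0"
proof -
  obtain \<phi> where \<phi>: "\<And>n. test_function \<Omega> (\<phi> n)" "L2_tendsto \<Omega> \<phi> f"
    "\<And>i. L2_tendsto \<Omega> (\<lambda>n. partial i (\<phi> n)) (weak_partial \<Omega> i f)"
    using H1_0_approx [OF \<Omega> f] by metis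
  obtain \<psi> where \<psi>: "\<And>n. test_function \<Omega> (\<psi> n)" "L2_tendsto \<Omega> \<psi> g"
    "\<And>i. L2_tendsto \<Omega> (\<lambda>n. partial i (\<psi> n)) (weak_partial \<Omega> i g)"
    using H1_0_approx [OF \<Omega> g] by metis
  have w: "(\<lambda>x::real^'d. inverse (1 + (x $ j)\<^sup>2)) \<in> borel_measurable (lebesgue_on \<Omega>)"
    "\<bar>inverse (1 + (x $ j)\<^sup>2)\<bar> \<le> 1" for x :: "real^'d"
    by (intro borel_measurable_lebesgue_on_continuous continuous_intros)
      (auto simp: add_nonneg_eq_0_iff inverse_le_1_iff)
  have m: "(\<lambda>x::real^'d. arctan (x $ j)) \<in> borel_measurable (lebesgue_on \<Omega>)"
    "\<bar>arctan (x $ j)\<bar> \<le> pi / 2" for x :: "real^'d"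
    using arctan_bounded [of "x $ j"]
    by (auto intro!: borel_measurable_lebesgue_on_continuous continuous_intros)
  \<comment> \<open>For test functions the three integrands add up to one partial derivative of a
    compactly supported function.\<close>
  have "(LINT x|lebesgue_on \<Omega>. \<phi> n x * (inverse (1 + (x $ j)\<^sup>2) * \<psi> n x)) +
    (LINT x|lebesgue_on \<Omega>. \<phi> n x * (arctan (x $ j) * partial j (\<psi> n) x)) +
    (LINT x|lebesgue_on \<Omega>. \<psi> n x * (arctan (x $ j) * partial j (\<phi> n) x)) = 0" for n
  proof -
    note C1_compact = test_function_C1_compact [OF \<phi>(1), of j n] test_function_C1_compact [OF \<psi>(1), of j n]
    note L2 = test_function_L2 [OF \<Omega> \<phi>(1)] test_function_L2 [OF \<Omega> \<psi>(1)]
    have "(LINT x|lebesgue_on \<Omega>. \<phi> n x * (inverse (1 + (x $ j)\<^sup>2) * \<psi> n x)) +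
      (LINT x|lebesgue_on \<Omega>. \<phi> n x * (arctan (x $ j) * partial j (\<psi> n) x)) +
      (LINT x|lebesgue_on \<Omega>. \<psi> n x * (arctan (x $ j) * partial j (\<phi> n) x)) =
      (LINT x|lebesgue_on \<Omega>. partial j (\<lambda>x. arctan (x $ j) * (\<phi> n x * \<psi> n x)) x)"
      unfolding partial_arctan_mult [OF C1_compact]
      by (simp only: Bochner_Integration.integral_add Bochner_Integration.integrable_add
          L2_mult L2_bounded_mult [OF w] L2_bounded_mult [OF m] L2)
    also have "\<dots> = (LINT x|lborel. partial j (\<lambda>x. arctan (x $ j) * (\<phi> n x * \<psi> n x)) x)"
    proof (rule integral_lebesgue_on_eq_lborel [OF \<Omega>])
      show "continuous_on UNIV (partial j (\<lambda>x. arctan (x $ j) * (\<phi> n x * \<psi> n x)))"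
        using partial_arctan_mult(1) [OF C1_compact] by (simp add: C1_compact_def)
      show "partial j (\<lambda>x. arctan (x $ j) * (\<phi> n x * \<psi> n x)) x = 0" if "x \<notin> \<Omega>" for x
        unfolding partial_arctan_mult [OF C1_compact]
        using test_function_eq_0 [OF \<phi>(1) that] test_function_eq_0 [OF \<psi>(1) that] by simp
    qed
    also have "\<dots> = 0"
      by (rule integral_partial_eq_0 [OF partial_arctan_mult(1) [OF C1_compact]])
    finally show ?thesis .
  qed
  moreover have "(\<lambda>n. (LINT x|lebesgue_on \<Omega>. \<phi> n x * (inverse (1 + (x $ j)\<^sup>2) * \<psi> n x)) +
    (LINT x|lebesgue_on \<Omega>. \<phi> n x * (arctan (x $ j) * partial j (\<psi> n) x)) +
    (LINT x|lebesgue_on \<Omega>. \<psi> n x * (arctan (x $ j) * partial j (\<phi> n) x))) \<longlonglongrightarrow>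
    (LINT x|lebesgue_on \<Omega>. f x * (inverse (1 + (x $ j)\<^sup>2) * g x)) +
    (LINT x|lebesgue_on \<Omega>. f x * (arctan (x $ j) * weak_partial \<Omega> j g x)) +
    (LINT x|lebesgue_on \<Omega>. g x * (arctan (x $ j) * weak_partial \<Omega> j f x))"
    by (intro tendsto_add L2_tendsto_inner \<phi> \<psi> L2_tendsto_bounded_mult [OF w]
        L2_tendsto_bounded_mult [OF m])
  ultimately show ?thesis
    by (simp add: LIMSEQ_const_iff)
qed

section \<open>Finite element matrices\<close>

lemma form_matrix_quadratic: "x \<bullet> (form_matrix a b b *v x) = (\<Sum>i\<in>UNIV. \<Sum>j\<in>UNIV. x $ i * x $ j * a (b i) (b j))"
  by (simp add: form_matrix_def matrix_vector_mult_def inner_vec_def sum_distrib_left mult_ac)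

text \<open>A Gram matrix becomes a single integral, so that sign and vanishing of its quadratic
  form can be read off from a square.\<close>

lemma integral_gram:
  fixes f g :: "'n::finite \<Rightarrow> real^'d::finite \<Rightarrow> real" and x y :: "real^'n"
  assumes "\<And>a. f a \<in> L2 \<Omega>" "\<And>a. g a \<in> L2 \<Omega>"
  shows "(\<Sum>a\<in>UNIV. \<Sum>b\<in>UNIV. x $ a * y $ b * (LINT z|lebesgue_on \<Omega>. f a z * g b z)) =
    (LINT z|lebesgue_on \<Omega>. (\<Sum>a\<in>UNIV. x $ a * f a z) * (\<Sum>b\<in>UNIV. y $ b * g b z))"
proof -
  have int: "integrable (lebesgue_on \<Omega>) (\<lambda>z. f a z * g b z)" for a b
    using assms by (rule L2_mult)
  have "(LINT z|lebesgue_on \<Omega>. (\<Sum>a\<in>UNIV. x $ a * f a z) * (\<Sum>b\<in>UNIV. y $ b * g b z)) =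
    (LINT z|lebesgue_on \<Omega>. (\<Sum>a\<in>UNIV. \<Sum>b\<in>UNIV. x $ a * y $ b * (f a z * g b z)))"
    by (simp add: sum_product mult_ac)
  also have "\<dots> = (\<Sum>a\<in>UNIV. \<Sum>b\<in>UNIV. x $ a * y $ b * (LINT z|lebesgue_on \<Omega>. f a z * g b z))"
    using int by (simp add: Bochner_Integration.integral_sum)
  finally show ?thesis by simp
qed

lemma integral_L2_square_eq_0:
  assumes "f \<in> L2 \<Omega>" "(LINT x|lebesgue_on \<Omega>. f x * f x) = 0"
  shows "AE x in lebesgue_on \<Omega>. f x = 0"
  using integral_nonneg_eq_0_iff_AE [OF L2_mult [OF assms(1,1)]] assms(2) by simp

lemma basis_on_combination: "basis_on \<Omega> b V \<Longrightarrow> combination b c \<in> V"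
  by (auto simp: basis_on_def)

lemma basis_on_member:
  assumes "basis_on \<Omega> b V"
  shows "b a \<in> V"
proof -
  have "combination b (axis a 1) = b a"
    by (rule ext) (simp add: combination_def axis_def if_distrib [of "\<lambda>c. c *\<^sub>R _"] cong: if_cong)
  then show ?thesis using basis_on_combination [OF assms, of "axis a 1"] by simp
qed

lemma Q_form_pos_def:
  fixes \<psi> :: "'n::finite \<Rightarrow> real^'d::finite \<Rightarrow> real"
  assumes "basis_on \<Omega> \<psi> M" "M \<subseteq> L2 \<Omega>"
  shows "pos_def (form_matrix (Q_form \<Omega>) \<psi> \<psi>)"
  unfolding pos_def_def
proof (intro allI impI)
  fix x :: "real^'n" assume "x \<noteq> 0"
  have \<psi>: "\<psi> a \<in> L2 \<Omega>" for a using basis_on_member [OF assms(1)] assms(2) by blast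
  let ?q = "LINT z|lebesgue_on \<Omega>. combination \<psi> x z * combination \<psi> x z"
  have "x \<bullet> (form_matrix (Q_form \<Omega>) \<psi> \<psi> *v x) = ?q"
    by (simp add: form_matrix_quadratic Q_form_def integral_gram [OF \<psi> \<psi>] combination_def)
  moreover have "combination \<psi> x \<in> L2 \<Omega>"
    using basis_on_combination [OF assms(1)] assms(2) by blast
  then have "?q \<noteq> 0"
    using integral_L2_square_eq_0 assms(1) \<open>x \<noteq> 0\<close> unfolding basis_on_def by blast
  moreover have "?q \<ge> 0" by simp
  ultimately show "x \<bullet> (form_matrix (Q_form \<Omega>) \<psi> \<psi> *v x) > 0" by linarith
qed

lemma sum_rotate:
  "(\<Sum>i\<in>I. \<Sum>j\<in>J. \<Sum>k\<in>K. g i j k) = (\<Sum>j\<in>J. \<Sum>k\<in>K. \<Sum>i\<in>I. g i j k)"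
  by (subst sum.swap, rule sum.cong [OF refl], rule sum.swap)

lemma C_form_nonneg:
  fixes \<Omega> :: "(real^'d::finite) set"
  assumes "\<And>a. \<psi> a \<in> H1 \<Omega>"
  shows "x \<bullet> (form_matrix (C_form \<Omega>) \<psi> \<psi> *v x) \<ge> 0"
proof -
  note L2 = weak_partial_L2 [OF assms]
  have "C_form \<Omega> (\<psi> a) (\<psi> b) =
      (\<Sum>i\<in>UNIV. LINT z|lebesgue_on \<Omega>. weak_partial \<Omega> i (\<psi> a) z * weak_partial \<Omega> i (\<psi> b) z)" for a b
    using L2_mult [OF L2 L2] by (simp add: C_form_def grad_def inner_vec_def)
  then have "x \<bullet> (form_matrix (C_form \<Omega>) \<psi> \<psi> *v x) = (\<Sum>a\<in>UNIV. \<Sum>b\<in>UNIV. \<Sum>i\<in>UNIV. x $ a * x $ b *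
      (LINT z|lebesgue_on \<Omega>. weak_partial \<Omega> i (\<psi> a) z * weak_partial \<Omega> i (\<psi> b) z))"
    by (simp add: form_matrix_quadratic sum_distrib_left)
  also have "\<dots> = (\<Sum>i\<in>UNIV. \<Sum>a\<in>UNIV. \<Sum>b\<in>UNIV. x $ a * x $ b *
      (LINT z|lebesgue_on \<Omega>. weak_partial \<Omega> i (\<psi> a) z * weak_partial \<Omega> i (\<psi> b) z))"
    by (rule sum_rotate [symmetric])
  also have "\<dots> \<ge> 0"
    unfolding integral_gram [OF L2 L2] by (intro sum_nonneg integral_nonneg_AE) simp
  finally show ?thesis .
qed

text \<open>The factor 1/6 is 1/2 - 1/3: half of the symmetric gradient form becomes one half of the
  divergence form by \<open>H1_0_integral_swap\<close>, and the definition of the form subtracts one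
  third.\<close>

lemma K_form_eq:
  fixes \<Omega> :: "(real^'d::finite) set"
  assumes \<Omega>: "open \<Omega>" and u: "u \<in> H1_0_vec \<Omega>" and v: "v \<in> H1_0_vec \<Omega>"
  shows "K_form \<Omega> u v =
    1/2 * (\<Sum>i\<in>UNIV. \<Sum>j\<in>UNIV.
      LINT x|lebesgue_on \<Omega>. weak_partial \<Omega> j (\<lambda>y. u y $ i) x * weak_partial \<Omega> j (\<lambda>y. v y $ i) x)
    + 1/6 * (LINT x|lebesgue_on \<Omega>. divergence \<Omega> u x * divergence \<Omega> v x)"
proof -
  define U where "U i j = weak_partial \<Omega> j (\<lambda>y. u y $ i)" for i j
  define V where "V i j = weak_partial \<Omega> j (\<lambda>y. v y $ i)" for i j
  have H1_0: "(\<lambda>y. u y $ i) \<in> H1_0 \<Omega>" "(\<lambda>y. v y $ i) \<in> H1_0 \<Omega>" for i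
    using u v by (auto simp: H1_0_vec_def)
  then have L2: "U i j \<in> L2 \<Omega>" "V i j \<in> L2 \<Omega>" for i j
    unfolding U_def V_def by (auto intro!: weak_partial_L2 simp: H1_0_def)
  have int: "integrable (lebesgue_on \<Omega>) (\<lambda>x. U i j x * V k l x)" for i j k l
    using L2 by (rule L2_mult)
  define I where "I i j k l = (LINT x|lebesgue_on \<Omega>. U i j x * V k l x)" for i j k l
  have swap: "I i j j i = I i i j j" for i j
    unfolding I_def U_def V_def by (rule H1_0_integral_swap [OF \<Omega> H1_0])
  have "(LINT x|lebesgue_on \<Omega>. divergence \<Omega> u x * divergence \<Omega> v x) =
      (LINT x|lebesgue_on \<Omega>. (\<Sum>i\<in>UNIV. \<Sum>j\<in>UNIV. U i i x * V j j x))"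
    by (simp add: divergence_def trace_def grad_vec_def U_def V_def sum_product)
  also have "\<dots> = (\<Sum>i\<in>UNIV. \<Sum>j\<in>UNIV. I i i j j)"
    using int by (simp add: I_def)
  finally have div: "(LINT x|lebesgue_on \<Omega>. divergence \<Omega> u x * divergence \<Omega> v x) = (\<Sum>i\<in>UNIV. \<Sum>j\<in>UNIV. I i i j j)" .
  \<comment> \<open>The factor 1/4 comes from the two halves in the symmetric gradients; of the four
    products, two pairs agree after renaming the indices.\<close>
  have "(LINT x|lebesgue_on \<Omega>. sym_grad \<Omega> u x \<bullet> sym_grad \<Omega> v x) =
      (LINT x|lebesgue_on \<Omega>. (\<Sum>i\<in>UNIV. \<Sum>j\<in>UNIV.
        1/4 * (U i j x * V i j x + U i j x * V j i x + U j i x * V i j x + U j i x * V j i x)))"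
    by (simp add: sym_grad_def grad_vec_def inner_vec_def transpose_def U_def V_def algebra_simps
        sum.distrib flip: sum_distrib_left)
  also have "\<dots> = (\<Sum>i\<in>UNIV. \<Sum>j\<in>UNIV. 1/4 * (I i j i j + I i j j i + I j i i j + I j i j i))"
    using int by (simp add: I_def)
  also have "\<dots> = 1/4 * ((\<Sum>i\<in>UNIV. \<Sum>j\<in>UNIV. I i j i j) + (\<Sum>i\<in>UNIV. \<Sum>j\<in>UNIV. I i j j i)
      + (\<Sum>i\<in>UNIV. \<Sum>j\<in>UNIV. I j i i j) + (\<Sum>i\<in>UNIV. \<Sum>j\<in>UNIV. I j i j i))"
    by (simp only: sum.distrib flip: sum_distrib_left)
  also have "(\<Sum>i\<in>UNIV. \<Sum>j\<in>UNIV. I j i i j) = (\<Sum>i\<in>UNIV. \<Sum>j\<in>UNIV. I i j j i)"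
    by (rule sum.swap)
  also have "(\<Sum>i\<in>UNIV. \<Sum>j\<in>UNIV. I j i j i) = (\<Sum>i\<in>UNIV. \<Sum>j\<in>UNIV. I i j i j)"
    by (rule sum.swap)
  finally have "(LINT x|lebesgue_on \<Omega>. sym_grad \<Omega> u x \<bullet> sym_grad \<Omega> v x) =
      1/2 * (\<Sum>i\<in>UNIV. \<Sum>j\<in>UNIV. I i j i j) + 1/2 * (\<Sum>i\<in>UNIV. \<Sum>j\<in>UNIV. I i i j j)"
    unfolding swap by simp
  then have "K_form \<Omega> u v = 1/2 * (\<Sum>i\<in>UNIV. \<Sum>j\<in>UNIV. I i j i j) +
      1/6 * (LINT x|lebesgue_on \<Omega>. divergence \<Omega> u x * divergence \<Omega> v x)"
    by (simp add: K_form_def div)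
  then show ?thesis by (simp add: I_def U_def V_def)
qed

text \<open>Summing the weighted identity over all pairs with coefficients
  \<open>x $ a * x $ b\<close> gives the identity for the combination \<open>u\<close> itself. Its
  derivative terms drop out, and what is left is the integral of \<open>u\<close> squared against a
  positive weight.\<close>

lemma H1_0_combination_eq_0:
  fixes f :: "'n::finite \<Rightarrow> real^'d::finite \<Rightarrow> real" and x :: "real^'n"
  assumes \<Omega>: "open \<Omega>" and f: "\<And>a. f a \<in> H1_0 \<Omega>"
    and 0: "AE z in lebesgue_on \<Omega>. (\<Sum>a\<in>UNIV. x $ a * weak_partial \<Omega> j (f a) z) = 0"
  shows "AE z in lebesgue_on \<Omega>. (\<Sum>a\<in>UNIV. x $ a * f a z) = 0"
proof -
  have fL2: "f a \<in> L2 \<Omega>" and wpL2: "weak_partial \<Omega> j (f a) \<in> L2 \<Omega>" for a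
    using f [of a] by (auto simp: H1_0_def intro: H1_L2 weak_partial_L2)
  define w where "w z = inverse (1 + (z $ j)\<^sup>2)" for z :: "real^'d"
  have w: "w \<in> borel_measurable (lebesgue_on \<Omega>)" "\<bar>w z\<bar> \<le> 1" "w z > 0" for z
    unfolding w_def
    by (intro borel_measurable_lebesgue_on_continuous continuous_intros)
      (auto simp: add_nonneg_eq_0_iff inverse_le_1_iff add_pos_nonneg)
  have m: "(\<lambda>z::real^'d. arctan (z $ j)) \<in> borel_measurable (lebesgue_on \<Omega>)"
    "\<bar>arctan (z $ j)\<bar> \<le> pi / 2" for z :: "real^'d"
    using arctan_bounded [of "z $ j"]
    by (auto intro!: borel_measurable_lebesgue_on_continuous continuous_intros)
  have pull: "(\<Sum>b\<in>UNIV. x $ b * (c * h b)) = c * (\<Sum>b\<in>UNIV. x $ b * h b)" for c and h :: "'n \<Rightarrow> real"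
    by (simp add: sum_distrib_left mult.left_commute)
  have ae0: "(LINT z|lebesgue_on \<Omega>. (\<Sum>a\<in>UNIV. x $ a * f a z) *
      (\<Sum>b\<in>UNIV. x $ b * (arctan (z $ j) * weak_partial \<Omega> j (f b) z))) = 0"
  proof (rule integral_eq_zero_AE)
    show "AE z in lebesgue_on \<Omega>. (\<Sum>a\<in>UNIV. x $ a * f a z) *
      (\<Sum>b\<in>UNIV. x $ b * (arctan (z $ j) * weak_partial \<Omega> j (f b) z)) = 0"
      using 0 by eventually_elim (simp add: pull)
  qed
  define u where "u z = (\<Sum>a\<in>UNIV. x $ a * f a z)" for z
  have "0 = (\<Sum>a\<in>UNIV. \<Sum>b\<in>UNIV. x $ a * x $ b * (
      (LINT z|lebesgue_on \<Omega>. f a z * (w z * f b z)) +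
      (LINT z|lebesgue_on \<Omega>. f a z * (arctan (z $ j) * weak_partial \<Omega> j (f b) z)) +
      (LINT z|lebesgue_on \<Omega>. f b z * (arctan (z $ j) * weak_partial \<Omega> j (f a) z))))"
    unfolding w_def H1_0_integral_weight [OF \<Omega> f f] by simp
  also have "\<dots> = (\<Sum>a\<in>UNIV. \<Sum>b\<in>UNIV. x $ a * x $ b * (LINT z|lebesgue_on \<Omega>. f a z * (w z * f b z))) +
      (\<Sum>a\<in>UNIV. \<Sum>b\<in>UNIV. x $ a * x $ b * (LINT z|lebesgue_on \<Omega>. f a z * (arctan (z $ j) * weak_partial \<Omega> j (f b) z))) +
      (\<Sum>a\<in>UNIV. \<Sum>b\<in>UNIV. x $ a * x $ b * (LINT z|lebesgue_on \<Omega>. f b z * (arctan (z $ j) * weak_partial \<Omega> j (f a) z)))"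
    by (simp only: distrib_left sum.distrib)
  \<comment> \<open>Renaming the two indices identifies the two derivative sums, so
    \<open>ae0\<close> disposes of both.\<close>
  also have "(\<Sum>a\<in>UNIV. \<Sum>b\<in>UNIV. x $ a * x $ b * (LINT z|lebesgue_on \<Omega>. f b z * (arctan (z $ j) * weak_partial \<Omega> j (f a) z))) =
      (\<Sum>a\<in>UNIV. \<Sum>b\<in>UNIV. x $ a * x $ b * (LINT z|lebesgue_on \<Omega>. f a z * (arctan (z $ j) * weak_partial \<Omega> j (f b) z)))"
    by (subst sum.swap) (simp only: mult.commute)
  also have "(\<Sum>a\<in>UNIV. \<Sum>b\<in>UNIV. x $ a * x $ b * (LINT z|lebesgue_on \<Omega>. f a z * (arctan (z $ j) * weak_partial \<Omega> j (f b) z))) = 0"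
    unfolding integral_gram [OF fL2 L2_bounded_mult [OF m wpL2]] by (rule ae0)
  also have "(\<Sum>a\<in>UNIV. \<Sum>b\<in>UNIV. x $ a * x $ b * (LINT z|lebesgue_on \<Omega>. f a z * (w z * f b z))) =
      (LINT z|lebesgue_on \<Omega>. w z * (u z * u z))"
    unfolding integral_gram [OF fL2 L2_bounded_mult [OF w(1,2) fL2]] u_def pull
    by (simp add: mult.left_commute)
  finally have int0: "(LINT z|lebesgue_on \<Omega>. w z * (u z * u z)) = 0" by simp
  have uL2: "u \<in> L2 \<Omega>"
    unfolding u_def by (intro L2_sum L2_scale fL2)
  have int: "integrable (lebesgue_on \<Omega>) (\<lambda>z. w z * (u z * u z))"
    using L2_mult [OF uL2 L2_bounded_mult [OF w(1,2) uL2]] by (simp add: mult.left_commute)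
  have "AE z in lebesgue_on \<Omega>. 0 \<le> w z * (u z * u z)"
    by (intro AE_I2 mult_nonneg_nonneg less_imp_le [OF w(3)] zero_le_square)
  from integral_nonneg_eq_0_iff_AE [OF int this] int0
  have "AE z in lebesgue_on \<Omega>. w z * (u z * u z) = 0" by (rule iffD1)
  moreover have "w z \<noteq> 0" for z using w(3) [of z] by simp
  ultimately show ?thesis
    unfolding u_def [symmetric] by simp
qed

text \<open>The divergence term only adds something nonnegative. If the squared norms
  \<open>N i j\<close> all vanished, each component of the combination would be zero almost
  everywhere, against linear independence modulo null sets.\<close>

lemma K_form_pos_def:
  fixes \<Omega> :: "(real^'d::finite) set" and \<phi> :: "'n::finite \<Rightarrow> real^'d \<Rightarrow> real^'d"
  assumes \<Omega>: "open \<Omega>" and basis: "basis_on \<Omega> \<phi> X" and X: "X \<subseteq> H1_0_vec \<Omega>"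
  shows "pos_def (form_matrix (K_form \<Omega>) \<phi> \<phi>)"
  unfolding pos_def_def
proof (intro allI impI)
  fix x :: "real^'n" assume "x \<noteq> 0"
  have \<phi>: "\<phi> a \<in> H1_0_vec \<Omega>" for a using basis_on_member [OF basis] X by blast
  then have \<phi>': "(\<lambda>y. \<phi> a y $ i) \<in> H1_0 \<Omega>" for a i by (simp add: H1_0_vec_def)
  define U where "U i j a = weak_partial \<Omega> j (\<lambda>y. \<phi> a y $ i)" for i j a
  have L2: "U i j a \<in> L2 \<Omega>" for i j a
    unfolding U_def using \<phi>' [of a i] by (auto intro!: weak_partial_L2 simp: H1_0_def)
  have div: "divergence \<Omega> (\<phi> a) \<in> L2 \<Omega>" for a
  proof -
    have "divergence \<Omega> (\<phi> a) = (\<lambda>x. \<Sum>i\<in>UNIV. U i i a x)"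
      by (simp add: fun_eq_iff divergence_def trace_def grad_vec_def U_def)
    then show ?thesis using L2 by (simp add: L2_sum)
  qed
  define N where "N i j = (LINT z|lebesgue_on \<Omega>. (\<Sum>a\<in>UNIV. x $ a * U i j a z) * (\<Sum>a\<in>UNIV. x $ a * U i j a z))" for i j
  define D where "D = (LINT z|lebesgue_on \<Omega>. (\<Sum>a\<in>UNIV. x $ a * divergence \<Omega> (\<phi> a) z) * (\<Sum>a\<in>UNIV. x $ a * divergence \<Omega> (\<phi> a) z))"
  have "x \<bullet> (form_matrix (K_form \<Omega>) \<phi> \<phi> *v x) =
     1/2 * (\<Sum>a\<in>UNIV. \<Sum>b\<in>UNIV. \<Sum>i\<in>UNIV. \<Sum>j\<in>UNIV. x $ a * x $ b * (LINT z|lebesgue_on \<Omega>. U i j a z * U i j b z))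
     + 1/6 * (\<Sum>a\<in>UNIV. \<Sum>b\<in>UNIV. x $ a * x $ b * (LINT z|lebesgue_on \<Omega>. divergence \<Omega> (\<phi> a) z * divergence \<Omega> (\<phi> b) z))"
    unfolding form_matrix_quadratic K_form_eq [OF \<Omega> \<phi> \<phi>] U_def
    by (simp add: distrib_left sum.distrib sum_distrib_left mult_ac)
  also have "(\<Sum>a\<in>UNIV. \<Sum>b\<in>UNIV. \<Sum>i\<in>UNIV. \<Sum>j\<in>UNIV. x $ a * x $ b * (LINT z|lebesgue_on \<Omega>. U i j a z * U i j b z)) =
     (\<Sum>i\<in>UNIV. \<Sum>j\<in>UNIV. \<Sum>a\<in>UNIV. \<Sum>b\<in>UNIV. x $ a * x $ b * (LINT z|lebesgue_on \<Omega>. U i j a z * U i j b z))"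
    by (simp only: sum_rotate [where I = "UNIV :: 'n set" and J = "UNIV :: 'd set" and K = "UNIV :: 'd set"])
  finally have eq: "x \<bullet> (form_matrix (K_form \<Omega>) \<phi> \<phi> *v x) = 1/2 * (\<Sum>i\<in>UNIV. \<Sum>j\<in>UNIV. N i j) + 1/6 * D"
    unfolding integral_gram [OF L2 L2] integral_gram [OF div div] N_def D_def .
  have N: "N i j \<ge> 0" for i j by (simp add: N_def)
  have D: "D \<ge> 0" by (simp add: D_def)
  have "(\<Sum>i\<in>UNIV. \<Sum>j\<in>UNIV. N i j) \<noteq> 0"
  proof
    assume "(\<Sum>i\<in>UNIV. \<Sum>j\<in>UNIV. N i j) = 0"
    then have "N i j = 0" for i j
      using N by (simp add: sum_nonneg_eq_0_iff sum_nonneg)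
    then have "AE z in lebesgue_on \<Omega>. (\<Sum>a\<in>UNIV. x $ a * U i j a z) = 0" for i j
      unfolding N_def by (intro integral_L2_square_eq_0 L2_sum L2_scale L2)
    then have "AE z in lebesgue_on \<Omega>. (\<Sum>a\<in>UNIV. x $ a * \<phi> a z $ i) = 0" for i
      unfolding U_def by (rule H1_0_combination_eq_0 [OF \<Omega> \<phi>'])
    then have "AE z in lebesgue_on \<Omega>. \<forall>i. (\<Sum>a\<in>UNIV. x $ a * \<phi> a z $ i) = 0"
      by (simp add: AE_all_countable)
    then have "AE z in lebesgue_on \<Omega>. combination \<phi> x z = 0"
      by eventually_elim (simp add: combination_def vec_eq_iff)
    then show False using basis \<open>x \<noteq> 0\<close> by (simp add: basis_on_def)
  qed
  moreover have "(\<Sum>i\<in>UNIV. \<Sum>j\<in>UNIV. N i j) \<ge> 0" using N by (intro sum_nonneg)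
  ultimately show "x \<bullet> (form_matrix (K_form \<Omega>) \<phi> \<phi> *v x) > 0"
    unfolding eq using D by linarith
qed

section \<open>Mean-zero constants and the eigenvalue theorem\<close>

lemma L2_0_const_eq_0:
  fixes f :: "real^'d::finite \<Rightarrow> real"
  assumes \<Omega>: "open \<Omega>" "\<Omega> \<noteq> {}" and f: "f \<in> L2_0 \<Omega>" and ae: "AE x in lebesgue_on \<Omega>. f x = c"
  shows "c = 0"
proof (rule ccontr)
  assume c: "c \<noteq> 0"
  have meas: "f \<in> borel_measurable (lebesgue_on \<Omega>)" using f by (simp add: L2_0_def L2_def)
  \<comment> \<open>Finite measure has to come first: \<open>measure\<close> is also 0 for a set of
    infinite measure, and only then does measure zero contradict that \<Omega> is open and
    nonempty.\<close>
  have "integrable (lebesgue_on \<Omega>) (\<lambda>x. c)"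
    using f integrable_cong_AE [OF meas _ ae] by (simp add: L2_0_def)
  then have "integrable (lebesgue_on \<Omega>) (\<lambda>x. c * indicator \<Omega> x)"
    by (rule Bochner_Integration.integrable_cong [THEN iffD1, rotated 2]) auto
  then have fin: "emeasure (lebesgue_on \<Omega>) \<Omega> < \<infinity>"
    using c \<Omega>(1) by (simp add: integrable_indicator_iff)
  have "(LINT x|lebesgue_on \<Omega>. c) = 0"
    using f integral_cong_AE [OF meas _ ae] by (simp add: L2_0_def)
  then have "measure (lebesgue_on \<Omega>) \<Omega> = 0" using c by simp
  then have "emeasure lebesgue \<Omega> = 0"
    using fin \<Omega>(1) by (auto simp: measure_def enn2real_eq_0_iff emeasure_restrict_space)
  then have "negligible \<Omega>"
    using \<Omega>(1) by (simp add: negligible_iff_null_sets null_sets_def)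
  then show False using \<Omega> open_not_negligible by blast
qed

theorem theorem4p2:
  fixes \<Omega> :: "(real^'d::finite) set"
    and X\<^sub>h :: "(real^'d \<Rightarrow> real^'d) set" and M\<^sub>h :: "(real^'d \<Rightarrow> real) set"
    and \<phi> :: "'nu::finite \<Rightarrow> real^'d \<Rightarrow> real^'d" and \<psi> :: "'np::finite \<Rightarrow> real^'d \<Rightarrow> real"
    and \<eta> \<zeta> k \<sigma> :: real
    and K :: "real^'nu^'nu" and G :: "real^'nu^'np" and C Q R S T :: "real^'np^'np"
    and A P :: "real^('nu + 'np + 'np)^('nu + 'np + 'np)"
  assumes "CARD('d) \<le> 3" and "is_domain \<Omega>"
    and "X\<^sub>h \<subseteq> H1_0_vec \<Omega>" and "basis_on \<Omega> \<phi> X\<^sub>h"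
    and "M\<^sub>h \<subseteq> H1 \<Omega> \<inter> L2_0 \<Omega>" and "basis_on \<Omega> \<psi> M\<^sub>h"
    and K: "K = form_matrix (K_form \<Omega>) \<phi> \<phi>"
    and G: "G = form_matrix (G_form \<Omega>) \<psi> \<phi>"
    and C: "C = form_matrix (C_form \<Omega>) \<psi> \<psi>"
    and Q: "Q = form_matrix (Q_form \<Omega>) \<psi> \<psi>"
    and kernel: "\<And>p. transpose G *v p = 0 \<Longrightarrow>
                   \<exists>c. AE x in lebesgue_on \<Omega>. combination \<psi> p x = c"
    and "\<eta> > 0" and "\<zeta> > 0" and "k > 0"
    and "\<sigma> < 0 \<or> \<sigma> \<in> {0<..<1}"
    and R: "R = - (1 / (\<sigma> * \<eta>)) *\<^sub>R (G ** matrix_inv K ** transpose G)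
              + (1 / (\<sigma> * \<eta>\<^sup>2)) *\<^sub>R
                  ((G ** matrix_inv K ** transpose G)
                   ** matrix_inv ((1 / \<eta>) *\<^sub>R (G ** matrix_inv K ** transpose G) + (1 / \<zeta>) *\<^sub>R Q)
                   ** (G ** matrix_inv K ** transpose G))
              - (k / \<sigma>) *\<^sub>R C"
    and S: "S = - ((1 / \<eta>) *\<^sub>R (G ** matrix_inv K ** transpose G) + (1 / \<zeta>) *\<^sub>R Q)"
    and T: "T = - (1 / \<eta>) *\<^sub>R (G ** matrix_inv K ** transpose G)"
    and A: "A = block_mat
              (\<eta> *\<^sub>R K) (transpose G)  (transpose G)
              G         (- k *\<^sub>R C)   0
              G         0              (- (1 / \<zeta>) *\<^sub>R Q)"
    and P: "P = block_mat
              (\<eta> *\<^sub>R K) 0  0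
              G         R  0
              G         T  S"
  shows "invertible R \<and>
         gen_eigenvalues A P = {1, \<sigma>} \<and>
         gen_eigenvalues (complex_mat A) (complex_mat P) = {1, complex_of_real \<sigma>} \<and>
         (\<forall>x. gen_eigenvector A P 1 x \<longrightarrow> (\<exists>u. x = block_vec u 0 0)) \<and>
         (\<forall>x. gen_eigenvector (complex_mat A) (complex_mat P) 1 x \<longrightarrow> (\<exists>u. x = block_vec u 0 0))"
proof -
  have \<Omega>: "open \<Omega>" "\<Omega> \<noteq> {}"
    using \<open>is_domain \<Omega>\<close> by (simp_all add: is_domain_def)
  note X = \<open>X\<^sub>h \<subseteq> H1_0_vec \<Omega>\<close> \<open>basis_on \<Omega> \<phi> X\<^sub>h\<close>
  note M = \<open>M\<^sub>h \<subseteq> H1 \<Omega> \<inter> L2_0 \<Omega>\<close> \<open>basis_on \<Omega> \<psi> M\<^sub>h\<close>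
  have \<sigma>: "\<sigma> \<noteq> 0" "\<sigma> \<noteq> 1" "\<sigma> < 1" using \<open>\<sigma> < 0 \<or> \<sigma> \<in> {0<..<1}\<close> by auto
  have posK: "pos_def K" unfolding K by (rule K_form_pos_def [OF \<Omega>(1) X(2,1)])
  have "M\<^sub>h \<subseteq> L2 \<Omega>" using M(1) H1_L2 by blast
  then have posQ: "pos_def Q" unfolding Q by (rule Q_form_pos_def [OF M(2)])
  have "\<psi> a \<in> H1 \<Omega>" for a using basis_on_member [OF M(2)] M(1) by blast
  then have nonnegC: "x \<bullet> (C *v x) \<ge> 0" for x unfolding C by (rule C_form_nonneg)
  have Gt: "p = 0" if p: "transpose G *v p = 0" for p
  proof -
    obtain c where c: "AE x in lebesgue_on \<Omega>. combination \<psi> p x = c" using kernel [OF p] by (elim exE)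
    have "combination \<psi> p \<in> L2_0 \<Omega>" using basis_on_combination [OF M(2)] M(1) by blast
    from L2_0_const_eq_0 [OF \<Omega> this c] have "AE x in lebesgue_on \<Omega>. combination \<psi> p x = 0"
      using c by (rule subst)
    with M(2) show ?thesis unfolding basis_on_def by blast
  qed

  \<comment> \<open>The parameters are absorbed into the blocks, which gives \<open>A\<close> and
    \<open>P\<close> the shape of \<open>saddle_point_eigenpairs\<close>; in particular
    \<open>N\<close> is the inverse of the scaled \<open>K\<close>.\<close>
  define B where "B = (1 / \<eta>) *\<^sub>R (G ** matrix_inv K ** transpose G)"
  define q where "q = (1 / \<zeta>) *\<^sub>R Q"
  define C' where "C' = k *\<^sub>R C"
  define W where "W = matrix_inv (B + q)"
  define D where "D = B - B ** W ** B"
  define N where "N = (1 / \<eta>) *\<^sub>R matrix_inv K"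
  have posB: "pos_def B"
    unfolding B_def using \<open>\<eta> > 0\<close> by (intro pos_def_scaleR pos_def_Schur posK Gt) auto
  have posq: "pos_def q"
    unfolding q_def using \<open>\<zeta> > 0\<close> by (intro pos_def_scaleR posQ) auto
  have posBq: "pos_def (B + q)" by (rule pos_def_add [OF posB pos_def_nonneg [OF posq]])
  have W: "(B + q) ** W = mat 1" "W ** (B + q) = mat 1"
    unfolding W_def by (rule matrix_inv_both [OF pos_def_invertible [OF posBq]])+
  have posD: "pos_def D" unfolding D_def W_def by (rule pos_def_parallel_sum [OF posB posq])
  \<comment> \<open>The two cases used are \<open>c = 1\<close>, for \<Phi> other than 1, and
    \<open>c = 1 - \<sigma>\<close>, for \<Phi> = 1; the latter is nonnegative since \<sigma> <
    1.\<close>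
  have posDC: "pos_def (D + c *\<^sub>R C')" if "c \<ge> 0" for c
    using posD nonnegC that \<open>k > 0\<close>
    by (intro pos_def_add) (simp_all add: C'_def scaleR_matrix_vector_assoc [symmetric])
  have KN: "(\<eta> *\<^sub>R K) ** N = mat 1" "N ** (\<eta> *\<^sub>R K) = mat 1"
    using matrix_inv_both [OF pos_def_invertible [OF posK]] \<open>\<eta> > 0\<close>
    by (simp_all add: N_def matrix_scalar_ac flip: scalar_matrix_assoc)
  have BN: "B = G ** N ** transpose G"
    by (simp add: B_def N_def matrix_scalar_ac flip: scalar_matrix_assoc)
  \<comment> \<open>The square of \<eta> in the second term of \<open>R\<close> is distributed over
    the two outer factors \<open>B\<close>.\<close>
  have R': "R = - (1 / \<sigma>) *\<^sub>R (D + C')"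
    unfolding R D_def C'_def W_def q_def B_def
    by (simp add: matrix_scalar_ac scaleR_add_right scaleR_diff_right power2_eq_square flip: scalar_matrix_assoc)
  have S': "S = - (B + q)" by (simp add: S B_def q_def)
  have T': "T = - B" by (simp add: T B_def)
  have A': "A = block_mat (\<eta> *\<^sub>R K) (transpose G) (transpose G) G (- C') 0 G 0 (- q)"
    by (simp add: A C'_def q_def)
  have P': "P = block_mat (\<eta> *\<^sub>R K) 0 0 G R 0 G (- B) (- (B + q))"
    by (simp add: P T' S')

  have E: "p = 0" if "(D + C') *v p = 0" for p
    using pos_def_injective [OF posDC [of 1]] that by simp
  have F: "p = 0" if "(D + (1 - \<sigma>) *\<^sub>R C') *v p = 0" for p
    using pos_def_injective [OF posDC [of "1 - \<sigma>"]] that \<sigma> by simp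
  have Rv: "\<sigma> *s (R *v p) = - (D *v p + C' *v p)" for p
    unfolding R' scaleR_matrix_vector_assoc [symmetric] scalar_mult_eq_scaleR matrix_vector_mult_add_rdistrib
    using \<sigma> by simp
  have "invertible R"
    unfolding invertible_left_inverse matrix_left_invertible_ker
  proof (intro allI impI)
    fix p assume "R *v p = 0"
    then have "(D + C') *v p = 0"
      using Rv [of p] by (simp add: matrix_vector_mult_add_rdistrib neg_equal_0_iff_equal del: minus_add_distrib)
    then show "p = 0" by (rule E)
  qed

  have real: "gen_eigenvalues A P = {1, \<sigma>}" "gen_eigenvector A P 1 x \<Longrightarrow> \<exists>u. x = block_vec u 0 0" for x
  proof -
    note saddle_point_eigenpairs [OF KN BN W(2,1) D_def Gt, of C' \<sigma> R, folded A' P']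
    moreover have "D *v p + C' *v p = 0 \<Longrightarrow> p = 0" for p
      using E [of p] by (simp add: matrix_vector_mult_add_rdistrib)
    moreover have "D *v p + (1 - \<sigma>) *s (C' *v p) = 0 \<Longrightarrow> p = 0" for p
      using F [of p]
      by (simp add: matrix_vector_mult_add_rdistrib scalar_mult_eq_scaleR flip: scaleR_matrix_vector_assoc)
    ultimately show "gen_eigenvalues A P = {1, \<sigma>}" "gen_eigenvector A P 1 x \<Longrightarrow> \<exists>u. x = block_vec u 0 0" for x
      using \<sigma> Rv by blast+
  qed

  note cm = complex_mat_mult [symmetric] complex_mat_add [symmetric] complex_mat_diff [symmetric]
  have cA: "complex_mat A = block_mat (complex_mat (\<eta> *\<^sub>R K)) (complex_mat (transpose G)) (complex_mat (transpose G))
      (complex_mat G) (- complex_mat C') 0 (complex_mat G) 0 (- complex_mat q)"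
    by (simp add: A' complex_mat_block_mat complex_mat_uminus complex_mat_0)
  have cP: "complex_mat P = block_mat (complex_mat (\<eta> *\<^sub>R K)) 0 0
      (complex_mat G) (complex_mat R) 0 (complex_mat G) (- complex_mat B) (- (complex_mat B + complex_mat q))"
    by (simp add: P' complex_mat_block_mat complex_mat_uminus complex_mat_0 complex_mat_diff)
  have complex: "gen_eigenvalues (complex_mat A) (complex_mat P) = {1, complex_of_real \<sigma>}"
    "gen_eigenvector (complex_mat A) (complex_mat P) 1 x \<Longrightarrow> \<exists>u. x = block_vec u 0 0" for x
  proof -
    \<comment> \<open>Complexification respects sums and products, which transports the matrix
      identities; the injectivity statements follow by \<open>complex_mat_injective\<close> from
      their real versions.\<close>
    have KN': "complex_mat (\<eta> *\<^sub>R K) ** complex_mat N = mat 1" "complex_mat N ** complex_mat (\<eta> *\<^sub>R K) = mat 1"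
      and W': "complex_mat W ** (complex_mat B + complex_mat q) = mat 1"
        "(complex_mat B + complex_mat q) ** complex_mat W = mat 1"
      unfolding cm KN W by (simp_all add: complex_mat_mat)
    have BN': "complex_mat B = complex_mat G ** complex_mat N ** complex_mat (transpose G)"
      and D': "complex_mat D = complex_mat B - complex_mat B ** complex_mat W ** complex_mat B"
      unfolding cm BN [symmetric] D_def by (rule refl)+
    have Gt': "complex_mat (transpose G) *v p = 0 \<Longrightarrow> p = 0" for p
      using Gt by (rule complex_mat_injective)
    note saddle_point_eigenpairs [OF KN' BN' W' D' Gt', of "complex_mat C'" "complex_of_real \<sigma>" "complex_mat R", folded cA cP]
    moreover have "complex_mat D *v p + complex_mat C' *v p = 0 \<Longrightarrow> p = 0" for p
      by (rule complex_mat_injective [of "D + C'"], erule E)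
        (simp only: complex_mat_add matrix_vector_mult_add_rdistrib)
    moreover have "complex_mat D *v p + (1 - complex_of_real \<sigma>) *s (complex_mat C' *v p) = 0 \<Longrightarrow> p = 0" for p
      by (rule complex_mat_injective [of "D + (1 - \<sigma>) *\<^sub>R C'"], erule F)
        (simp only: complex_mat_add matrix_vector_mult_add_rdistrib complex_mat_scaleR_mult of_real_diff of_real_1)
    moreover have "complex_of_real \<sigma> *s (complex_mat R *v p) = - (complex_mat D *v p + complex_mat C' *v p)" for p
      unfolding R' complex_mat_scaleR_mult complex_mat_add matrix_vector_mult_add_rdistrib
      using \<sigma> by (simp add: vec_eq_iff)
    ultimately show "gen_eigenvalues (complex_mat A) (complex_mat P) = {1, complex_of_real \<sigma>}"
      "gen_eigenvector (complex_mat A) (complex_mat P) 1 x \<Longrightarrow> \<exists>u. x = block_vec u 0 0" for x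
      using \<sigma>(1,2) unfolding of_real_eq_0_iff [symmetric, where 'a = complex] of_real_eq_1_iff [symmetric, where 'a = complex]
      by blast+
  qed
  show ?thesis using \<open>invertible R\<close> real complex by blast
qed

end
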